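(* Let $\Sigma_i^{R;t_o,t_a}=(U_i^{R,-},U_i^{R,+})$, with $U_i^{R,\pm}=(\rho_i^{R,\pm},w_i^{R,\pm})$ and $w_i^{R,-}=w_i^{R,+}$, be a returning wave travelling on an incoming road $i\in\{1,\dots,n\}$ and interacting with the junction $J$ at time $t_a$. Let $\widetilde\rho_i^{R,-}$ be determined by $Q(\widetilde\rho_i^{R,-},w_i^{R,-})=Q(\rho_i^{R,-},w_i^{R,-})$ (the other density with the same flux). 1. If one of the following occurs: (a) $\Sigma_i^{R;t_o,t_a}$ is a shock wave; (b) $\Sigma_i^{R;t_o,t_a}$ is a rarefaction wave with $\widetilde\rho_i^{R,-}<\rho_i^{R,+}<\sigma(w_i^{R,+})=\sigma(w_i^{R,-})<\rho_i^{R,-}$; (c) the backward wave tree of $\Sigma_i^{R;t_o,t_a}$ includes only $\rho$-waves; then $$\delta_-Q_{\Sigma_i^{R;t_o,t_a}}=Q(\rho_i^{R,-},w_i^{R,-})-Q(\rho_i^{R,+},w_i^{R,+})<0.$$ 2. If $\Sigma_i^{R;t_o,t_a}$ is a rarefaction wave with $\rho_i^{R,+}<\widetilde\rho_i^{R,-}<\sigma(w_i^{R,-})<\rho_i^{R,-}$, and it is generated by the interaction of a $w$-wave $\Sigma^\ell=(U_i^{0,-},U_i^{0,+})$ (travelling along the road) with $U_i^{0,-}=U_i^{R,-}$ (so $w_i^{0,-}=w_i^{R,-}$) and the $\rho$-wave $\Sigma^r=(U_i^{0,+},\hat U_i)$ originated from the junction at time $t_o$, then $$0<\delta_-Q_{\Sigma_i^{R;t_o,t_a}}=Q(\rho_i^{R,-},w_i^{R,-})-Q(\rho_i^{R,+},w_i^{R,+})<C_*\,|w_i^{0,+}-w_i^{0,-}|.$$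 3. In the most general case where $\Sigma_i^{R;t_o,t_a}$ is a rarefaction wave with $\delta_-Q_{\Sigma_i^{R;t_o,t_a}}>0$, of order $K$, $$\delta_-Q_{\Sigma_i^{R;t_o,t_a}}\le C_*\,TV_{tree}^K+\sum_{r=1}^{N_\rho^{t_o}}[\delta_-Q_{\Sigma_r}]_+.$$ Here $[\cdot]_+$ is the positive part, $TV_{tree}^K=\sum_{k=2}^K|w^k-w^{k-1}|$, $N_\rho^{t_o}$ is the number of waves of level 1 at the original time $t_o$, $\Sigma_r$ are these ($\rho$-)waves of level 1, and $$C_*=2\sup_{\rho,\rho',\rho''\in[0,\rho_{\max}]}\ \sup_{w,w'\in[w_L,w_R]}\left(-\frac{\partial_wV(\rho,w)}{\partial_\rho V(\rho',w')}\right)V(\rho'',w').$$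
   Context: **Model.** Fix an interval $[w_L,w_R]$. The flux $Q(\rho,w)$ and velocity $V(\rho,w)=Q(\rho,w)/\rho$ (extended by continuity to $\rho=0$) are smooth functions for $\rho\in[0,\rho_{\max}]$, $w\in[w_L,w_R]$, satisfying for every $w$: $Q(0,w)=Q(\rho^{\max}(w),w)=0$, where $\rho^{\max}(w)\le\rho_{\max}$ is the maximal density; $\partial^2_\rho Q<0$; $Q_w\ge0$; $V\ge0$; $V_\rho<0$; $V_w\ge0$. $\sigma(w)$ is the unique maximum point of $Q(\cdot,w)$. On each road of a junction $J$ with $n$ incoming and $m$ outgoing roads the system $\partial_t\rho+\partial_x(\rho v)=0$, $\partial_ty+\partial_x(yv)=0$, $y=\rho w$, $v=V(\rho,w)$ is solved approximately by wave-front tracking (WFT): piecewise constant approximate solutions with finitely many fronts, obtained by solving Riemann problems at interactions inside the roads and, by a Riemann solver, at $J$ (rarefactions being approximated by small fronts). States are $U=(\rho,w)$. A $\rho$-wave (1-wave) keeps $w$ constant; it is a shock if the left density is smaller than the right one and a rarefaction if it is larger. A $w$-wave (2-contact discontinuity) keeps $V$ constant and travels with speed $V\ge0$. **Waves emitted on incoming roads.** On an incoming road with left state $U^-=(\rho^-,w^-)$ the Riemann solver emits at most a $\rho$-wave of negative speed, whose right state $(\hat\rho,\hat w)$ has $\hat w=w^-$ and $\hat\rho\in\{\rho^-\}\cup(\widetilde{\rho^-}(w^-),\rho^{\max}(w^-)]$ if $\rho^-\le\sigma(w^-)$ (where $\widetilde{\rho^-}(w^-)$ is the other density with the same flux), $\hat\rho\in[\sigma(w^-),\rho^{\max}(w^-)]$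 if $\rho^->\sigma(w^-)$ (no zero-speed jumps at $J$). **Flux variations.** For a wave $\Sigma=(U^-,U^+)$ with left state $U^-$ and right state $U^+$: $\delta_+Q_\Sigma=Q(\rho^+,w^+)-Q(\rho^-,w^-)$ and $\delta_-Q_\Sigma=-\delta_+Q_\Sigma$. **Backward wave tree/branch.** For a fixed road $I_s$ and a wave at a point $(x,t)$, the backward wave tree is obtained by tracing the fronts of the WFT solution (of both families) backward in time from $(x,t)$ to the boundary of $I_s\times[0,+\infty)$, recursively at each interaction point. A backward wave branch of it is a piecewise linear branch (or branches, when waves of the same family interact) containing only fronts of one family. **Returning wave.** A returning wave $\Sigma^{R;t_o,t_a}=(U^{R,-},U^{R,+})$ is a wave front generated at $J$ and interacting with $J$ at a later time $t_a$ (absorption time), so that its backward wave branch includes at least one wave of the same family originating from $J$ at an earlier time; $t_o<t_a$ (original time) is the greatest time at which a wave of the backward branch originated from $J$. Returning waves are always $\rho$-waves. **Levels and order.** Waves of the backward wave tree of $\Sigma^{R;t_o,t_a}$ travelling at time $t_o$ are of level 1. If a wave of level $k\ge1$ interacts with a $w$-wave, the interaction generates waves of level $k+1$; if it interacts with a $\rho$-wave, the generated waves are still of level $k$. The order $K$ of $\Sigma^{R;t_o,t_a}$ is the maximal level of waves in its backward wave tree. $w^k$ denotes the (constant) value of $w$ across the $\rho$-waves of level $k$ in the tree, so $|w^k-w^{k-1}|$ is the jump of $w$ across the $w$-wave responsible for the change of level from $k-1$ to $k$. *)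

theory Defs
  imports "HOL-Analysis.Analysis"
begin

section \<open>The model\<close>

text \<open>A state is the pair of density and Lagrangian marker \<open>(\<rho>, w)\<close>.\<close>

type_synonym state = "real \<times> real"

record model =
  flux :: "real \<Rightarrow> real \<Rightarrow> real"
  vel :: "real \<Rightarrow> real \<Rightarrow> real"
  rho_sup :: real  \<comment> \<open>\<open>\<rho>\<^sub>m\<^sub>a\<^sub>x\<close>, a bound independent of \<open>w\<close>\<close>
  rho_max :: "real \<Rightarrow> real"  \<comment> \<open>\<open>\<rho>\<^sup>m\<^sup>a\<^sup>x(w)\<close>\<close>
  w_lo :: real
  w_hi :: real

primrec Ck_on :: "nat \<Rightarrow> (real \<times> real) set \<Rightarrow> (real \<times> real \<Rightarrow> real) \<Rightarrow> bool" where
  "Ck_on 0 S f \<longleftrightarrow> continuous_on S f"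
| "Ck_on (Suc k) S f \<longleftrightarrow>
    (\<exists>f1 f2. (\<forall>p\<in>S. (f has_derivative (\<lambda>h. fst h * f1 p + snd h * f2 p)) (at p within S)) \<and>
      Ck_on k S f1 \<and> Ck_on k S f2)"

definition smooth_on :: "(real \<times> real) set \<Rightarrow> (real \<times> real \<Rightarrow> real) \<Rightarrow> bool" where
  "smooth_on S f \<longleftrightarrow> (\<forall>k. Ck_on k S f)"

text \<open>Partial derivatives on the rectangle, one-sided on its boundary.\<close>

definition d_rho :: "model \<Rightarrow> (real \<Rightarrow> real \<Rightarrow> real) \<Rightarrow> real \<Rightarrow> real \<Rightarrow> real" where
  "d_rho M f r w = vector_derivative (\<lambda>s. f s w) (at r within {0..rho_sup M})"

definition d_w :: "model \<Rightarrow> (real \<Rightarrow> real \<Rightarrow> real) \<Rightarrow> real \<Rightarrow> real \<Rightarrow> real" where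
  "d_w M f r w = vector_derivative (\<lambda>v. f r v) (at w within {w_lo M..w_hi M})"

text \<open>The differential conditions hold on the whole rectangle, over which \<open>C_star\<close> takes its
  suprema. The sign condition \<open>V \<ge> 0\<close> is for physical densities \<open>\<rho> \<le> \<rho>\<^sup>m\<^sup>a\<^sup>x(w)\<close>; beyond
  them strict concavity makes the flux negative. The value of \<open>V\<close> at \<open>\<rho> = 0\<close> is determined by
  its continuity.\<close>

definition traffic_model :: "model \<Rightarrow> bool" where
  "traffic_model M \<longleftrightarrow>
    w_lo M < w_hi M \<and>
    smooth_on ({0..rho_sup M} \<times> {w_lo M..w_hi M}) (\<lambda>(r, w). flux M r w) \<and>
    smooth_on ({0..rho_sup M} \<times> {w_lo M..w_hi M}) (\<lambda>(r, w). vel M r w) \<and>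
    (\<forall>w\<in>{w_lo M..w_hi M}.
      0 < rho_max M w \<and> rho_max M w \<le> rho_sup M \<and>
      flux M 0 w = 0 \<and> flux M (rho_max M w) w = 0 \<and>
      (\<forall>r\<in>{0<..rho_sup M}. vel M r w = flux M r w / r) \<and>
      (\<forall>r\<in>{0..rho_max M w}. 0 \<le> vel M r w) \<and>
      (\<forall>r\<in>{0..rho_sup M}.
        d_rho M (d_rho M (flux M)) r w < 0 \<and> 0 \<le> d_w M (flux M) r w \<and>
        d_rho M (vel M) r w < 0 \<and> 0 \<le> d_w M (vel M) r w))"

definition states :: "model \<Rightarrow> state set" where
  "states M = {(r, w). w \<in> {w_lo M..w_hi M} \<and> r \<in> {0..rho_max M w}}"

definition sigma :: "model \<Rightarrow> real \<Rightarrow> real" where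
  "sigma M w = (THE s. s \<in> {0..rho_max M w} \<and>
    (\<forall>r\<in>{0..rho_max M w}. flux M r w \<le> flux M s w))"

definition other_density :: "model \<Rightarrow> real \<Rightarrow> real \<Rightarrow> real" where
  "other_density M r w = (THE s. s \<in> {0..rho_max M w} \<and> flux M s w = flux M r w \<and>
    (s = r \<longleftrightarrow> r = sigma M w))"

definition C_star :: "model \<Rightarrow> real" where
  "C_star M = 2 *
    (SUP (r, r', r'', w, w') \<in>
        {0..rho_sup M} \<times> {0..rho_sup M} \<times> {0..rho_sup M} \<times> {w_lo M..w_hi M} \<times> {w_lo M..w_hi M}.
      (- (d_w M (vel M) r w / d_rho M (vel M) r' w')) * vel M r'' w')"


section \<open>Fronts\<close>

datatype family = Rho_family | W_family

record front =
  fam :: family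
  lst :: state  \<comment> \<open>left state\<close>
  rst :: state  \<comment> \<open>right state\<close>
  speed :: real
  x_start :: real
  t_start :: real
  t_end :: real

definition pos :: "front \<Rightarrow> real \<Rightarrow> real" where
  "pos f t = x_start f + speed f * (t - t_start f)"

definition x_end :: "front \<Rightarrow> real" where
  "x_end f = pos f (t_end f)"

definition state_flux :: "model \<Rightarrow> state \<Rightarrow> real" where
  "state_flux M U = flux M (fst U) (snd U)"

definition delta_plus :: "model \<Rightarrow> front \<Rightarrow> real" where
  "delta_plus M f = state_flux M (rst f) - state_flux M (lst f)"

definition delta_minus :: "model \<Rightarrow> front \<Rightarrow> real" where
  "delta_minus M f = - delta_plus M f"

definition shock :: "front \<Rightarrow> bool" where
  "shock f \<longleftrightarrow> fam f = Rho_family \<and> fst (lst f) < fst (rst f)"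

definition rarefaction :: "front \<Rightarrow> bool" where
  "rarefaction f \<longleftrightarrow> fam f = Rho_family \<and> fst (rst f) < fst (lst f)"

text \<open>Shocks move with the Rankine--Hugoniot speed. For a front approximating part of a rarefaction
  the speed may be any number between the two characteristic speeds; this covers the
  usual conventions (Rankine--Hugoniot speed, characteristic speed of one of the two states).\<close>

definition rho_wave :: "model \<Rightarrow> front \<Rightarrow> bool" where
  "rho_wave M f \<longleftrightarrow>
    fam f = Rho_family \<and> snd (lst f) = snd (rst f) \<and> fst (lst f) \<noteq> fst (rst f) \<and>
    (shock f \<longrightarrow> speed f = delta_plus M f / (fst (rst f) - fst (lst f))) \<and>
    (rarefaction f \<longrightarrow>
      d_rho M (flux M) (fst (lst f)) (snd (lst f)) \<le> speed f \<and>
      speed f \<le> d_rho M (flux M) (fst (rst f)) (snd (rst f)))"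

definition w_wave :: "model \<Rightarrow> front \<Rightarrow> bool" where
  "w_wave M f \<longleftrightarrow>
    fam f = W_family \<and> snd (lst f) \<noteq> snd (rst f) \<and>
    vel M (fst (lst f)) (snd (lst f)) = vel M (fst (rst f)) (snd (rst f)) \<and>
    speed f = vel M (fst (lst f)) (snd (lst f))"

primrec chain :: "state \<Rightarrow> front list \<Rightarrow> state \<Rightarrow> bool" where
  "chain U [] U' \<longleftrightarrow> U = U'"
| "chain U (f # fs) U' \<longleftrightarrow> lst f = U \<and> chain (rst f) fs U'"

text \<open>The approximate solution of a Riemann problem: a shock, or a rarefaction (possibly
  split into several fronts), followed by a 2-contact discontinuity, each of which may be absent.\<close>

definition riemann_fan :: "state \<Rightarrow> front list \<Rightarrow> state \<Rightarrow> bool" where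
  "riemann_fan Ul gs Ur \<longleftrightarrow>
    (\<exists>rs ws. gs = rs @ ws \<and> chain Ul gs Ur \<and>
      (\<forall>g\<in>set rs. fam g = Rho_family) \<and> (length rs \<le> 1 \<or> (\<forall>g\<in>set rs. rarefaction g)) \<and>
      (\<forall>g\<in>set ws. fam g = W_family) \<and> length ws \<le> 1)"


section \<open>Wave-front tracking on an incoming road\<close>

text \<open>The road is the interval from \<open>left_end\<close> (possibly \<open>-\<infinity>\<close>) to the position
  \<open>junction\<close> of \<open>J\<close>, and the approximate solution is considered up to the arbitrary
  time \<open>horizon\<close>, at which the fronts still present are cut off.\<close>

record road =
  left_end :: ereal
  junction :: real
  horizon :: real
  sol :: "real \<times> real \<Rightarrow> state"  \<comment> \<open>as a function of \<open>(x, t)\<close>\<close>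
  fronts :: "front set"

definition interior_pt :: "road \<Rightarrow> real \<Rightarrow> bool" where
  "interior_pt D x \<longleftrightarrow> left_end D < ereal x \<and> x < junction D"

definition ending_at :: "road \<Rightarrow> real \<Rightarrow> real \<Rightarrow> front set" where
  "ending_at D x t = {f \<in> fronts D. x_end f = x \<and> t_end f = t}"

definition starting_at :: "road \<Rightarrow> real \<Rightarrow> real \<Rightarrow> front set" where
  "starting_at D x t = {f \<in> fronts D. x_start f = x \<and> t_start f = t}"

definition passing_at :: "road \<Rightarrow> real \<Rightarrow> real \<Rightarrow> front set" where
  "passing_at D x t = {f \<in> fronts D. t_start f < t \<and> t < t_end f \<and> pos f t = x}"

definition interaction :: "road \<Rightarrow> real \<Rightarrow> real \<Rightarrow> bool" where
  "interaction D x t \<longleftrightarrow>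
    (\<exists>Ul Ur fs gs.
      distinct fs \<and> set fs = ending_at D x t \<and> chain Ul fs Ur \<and>
      sorted_wrt (\<lambda>f g. speed g \<le> speed f) fs \<and> (\<exists>f\<in>set fs. \<exists>g\<in>set fs. speed f \<noteq> speed g) \<and>
      distinct gs \<and> set gs = starting_at D x t \<and> riemann_fan Ul gs Ur)"

definition emitted_densities :: "model \<Rightarrow> real \<Rightarrow> real \<Rightarrow> real set" where
  "emitted_densities M r w =
    (if r \<le> sigma M w then {r} \<union> {other_density M r w<..rho_max M w}
     else {sigma M w..rho_max M w})"

definition emission :: "model \<Rightarrow> road \<Rightarrow> real \<Rightarrow> bool" where
  "emission M D t \<longleftrightarrow>
    (\<exists>r r' w gs. distinct gs \<and> set gs = starting_at D (junction D) t \<and>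
      riemann_fan (r, w) gs (r', w) \<and> (\<forall>g\<in>set gs. fam g = Rho_family) \<and>
      r' \<in> emitted_densities M r w)"

text \<open>
  Two fronts may share a position away from their end points only if they travel together,
  namely a shock with vacuum on its left and a w-wave adjacent to it; they then form the list
  in the condition on the traces of the solution. For the same reason it is required of an interaction that
  two of the incoming speeds are different. The fronts issuing from the initial
  datum and those entering or leaving through the left end of the road are unrestricted.\<close>

definition incoming_wft :: "model \<Rightarrow> road \<Rightarrow> bool" where
  "incoming_wft M D \<longleftrightarrow>
    left_end D < ereal (junction D) \<and> 0 < horizon D \<and> finite (fronts D) \<and>
    (\<forall>f\<in>fronts D.
      (rho_wave M f \<or> w_wave M f) \<and> lst f \<in> states M \<and> rst f \<in> states M \<and>
      0 \<le> t_start f \<and> t_start f < t_end f \<and> t_end f \<le> horizon D \<and>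
      (\<forall>t. t_start f < t \<and> t < t_end f \<longrightarrow> interior_pt D (pos f t))) \<and>
    (\<forall>f\<in>fronts D. \<forall>g\<in>fronts D. \<forall>t.
      t_start f < t \<and> t < t_end f \<and> t_start g \<le> t \<and> t \<le> t_end g \<and> pos f t = pos g t \<longrightarrow>
      t_start g < t \<and> t < t_end g \<and> speed f = speed g) \<and>
    (\<forall>x t. interior_pt D x \<and> 0 < t \<and> t < horizon D \<longrightarrow>
      sol D (x, t) \<in> states M \<and>
      ((\<forall>f\<in>fronts D. \<not> (t_start f \<le> t \<and> t \<le> t_end f \<and> pos f t = x)) \<longrightarrow>
        (\<forall>\<^sub>F q in nhds (x, t). sol D q = sol D (x, t))) \<and>
      (passing_at D x t \<noteq> {} \<longrightarrow>
        (\<exists>Ul Ur fs. distinct fs \<and> set fs = passing_at D x t \<and> chain Ul fs Ur \<and>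
          map fam fs \<in> {[Rho_family], [W_family], [Rho_family, W_family]} \<and>
          (\<forall>\<^sub>F y in at_left x. sol D (y, t) = Ul) \<and>
          (\<forall>\<^sub>F y in at_right x. sol D (y, t) = Ur))) \<and>
      (ending_at D x t \<union> starting_at D x t \<noteq> {} \<longrightarrow> interaction D x t)) \<and>
    (\<forall>t. 0 \<le> t \<and> t < horizon D \<longrightarrow> emission M D t)"


section \<open>Backward trees, returning waves, levels\<close>

text \<open>Backward tracing stops at the boundary of the road, hence in particular at \<open>J\<close>.\<close>

definition parents :: "road \<Rightarrow> front \<Rightarrow> front set" where
  "parents D f = (if interior_pt D (x_start f) then ending_at D (x_start f) (t_start f) else {})"

inductive_set wave_tree :: "road \<Rightarrow> front \<Rightarrow> front set" for D f where
  self: "f \<in> wave_tree D f"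
| parent: "h \<in> wave_tree D f \<Longrightarrow> g \<in> parents D h \<Longrightarrow> g \<in> wave_tree D f"

inductive_set wave_branch :: "road \<Rightarrow> front \<Rightarrow> front set" for D f where
  self: "f \<in> wave_branch D f"
| parent: "h \<in> wave_branch D f \<Longrightarrow> g \<in> parents D h \<Longrightarrow> fam g = fam f \<Longrightarrow> g \<in> wave_branch D f"

definition returning_wave :: "road \<Rightarrow> front \<Rightarrow> real \<Rightarrow> real \<Rightarrow> bool" where
  "returning_wave D S t_o t_a \<longleftrightarrow>
    S \<in> fronts D \<and> x_end S = junction D \<and> t_end S = t_a \<and> t_o < t_a \<and>
    (\<exists>g\<in>wave_branch D S. x_start g = junction D \<and> t_start g = t_o) \<and>
    (\<forall>g\<in>wave_branch D S. x_start g = junction D \<longrightarrow> t_start g \<le> t_o)"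

text \<open>Levels are carried from the \<open>\<rho>\<close>-waves entering an interaction to the waves generated
  by it. When \<open>\<rho>\<close>-waves of different levels merge, the level of the outcome is the largest one.\<close>

inductive has_level :: "road \<Rightarrow> front \<Rightarrow> real \<Rightarrow> front \<Rightarrow> nat \<Rightarrow> bool" for D S t_o where
  original: "f \<in> wave_tree D S \<Longrightarrow> t_start f \<le> t_o \<Longrightarrow> t_o < t_end f \<Longrightarrow> has_level D S t_o f 1"
| meets_w: "f \<in> wave_tree D S \<Longrightarrow> t_o < t_start f \<Longrightarrow> g \<in> parents D f \<Longrightarrow> fam g = Rho_family \<Longrightarrow>
    h \<in> parents D f \<Longrightarrow> fam h = W_family \<Longrightarrow> has_level D S t_o g k \<Longrightarrow> has_level D S t_o f (k + 1)"
| meets_rho: "f \<in> wave_tree D S \<Longrightarrow> t_o < t_start f \<Longrightarrow> g \<in> parents D f \<Longrightarrow> fam g = Rho_family \<Longrightarrow>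
    \<forall>h\<in>parents D f. fam h = Rho_family \<Longrightarrow> has_level D S t_o g k \<Longrightarrow> has_level D S t_o f k"

definition level :: "road \<Rightarrow> front \<Rightarrow> real \<Rightarrow> front \<Rightarrow> nat" where
  "level D S t_o f = Max {k. has_level D S t_o f k}"

definition returning_order :: "road \<Rightarrow> front \<Rightarrow> real \<Rightarrow> nat" where
  "returning_order D S t_o = Max {k. \<exists>f. has_level D S t_o f k}"

definition original_rho_waves :: "road \<Rightarrow> front \<Rightarrow> real \<Rightarrow> front set" where
  "original_rho_waves D S t_o =
    {f \<in> wave_tree D S. fam f = Rho_family \<and> t_start f \<le> t_o \<and> t_o < t_end f}"

text \<open>\<open>w\<^sup>k\<close> is the value of \<open>w\<close> across the \<open>\<rho>\<close>-waves of level \<open>k\<close>. This is required only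
  of those that descend from a wave leaving \<open>J\<close> at the original time: level-1 waves at that
  time may lie on both sides of a w-wave of the tree, so the value of \<open>w\<close> need not be constant
  on all waves of the same level. Any values that are constant on whole levels satisfy this.\<close>

definition level_values :: "road \<Rightarrow> front \<Rightarrow> real \<Rightarrow> (nat \<Rightarrow> real) \<Rightarrow> bool" where
  "level_values D S t_o wk \<longleftrightarrow>
    (\<forall>f\<in>wave_branch D S.
      (\<exists>g\<in>wave_branch D f. x_start g = junction D \<and> t_start g = t_o) \<longrightarrow>
      snd (lst f) = wk (level D S t_o f))"

definition TV_tree :: "(nat \<Rightarrow> real) \<Rightarrow> nat \<Rightarrow> real" where
  "TV_tree wk K = (\<Sum>k=2..K. \<bar>wk k - wk (k - 1)\<bar>)"

end

theory Submission
  imports Defs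
begin

text \<open>
  The argument reads the road through the velocity. A contact discontinuity does not change
  \<open>V\<close>, so jumps of \<open>V\<close> sit on \<open>\<rho>\<close>-waves only and pass through contact discontinuities
  unaltered, while \<open>w\<close> jumps on contact discontinuities only.

  Let \<open>S\<close>, with states \<open>(a, w)\<close> and \<open>(b, w)\<close>, be a returning rarefaction, so \<open>b < a\<close>. Go back in
  time from \<open>S\<close>, at each interaction continuing with the rightmost incoming \<open>\<rho>\<close>-front. Fronts of
  the first family cannot cross without interacting, so the path obtained stays between the
  junction and any branch of \<open>S\<close> that leads back to \<open>J\<close> at the original time. It is thus trapped and must
  itself end at \<open>J\<close>; since no later emission belongs to the branch of \<open>S\<close>, it ends there
  at the original time, on a front \<open>f\<close> with right state \<open>(r, w0)\<close>. Only contact discontinuities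
  lie to the right of the path at an interaction, hence \<open>V(b, w) \<le> V(r, w0)\<close>
  (\<open>rightmost_branch_reaches_junction\<close>). The Riemann solver at \<open>J\<close> emits only congested states, so
  \<open>r \<ge> \<sigma>(w0)\<close> (\<open>emitted_right_density\<close>).

  Transport both states of \<open>S\<close> to the line \<open>w0\<close> along level curves of \<open>V\<close>. The velocities are at
  most \<open>V(r, w0)\<close>, so the new densities are at least \<open>r\<close> and lie on the decreasing branch of
  the flux: after the transport, the flux at the left state is smaller than at the right state.
  The transport itself changes each of the two fluxes by at most \<open>C\<^sub>* / 2\<close> times the variation of \<open>w\<close>
  (\<open>level_curve_bound\<close>). Therefore \<open>\<delta>\<^sub>-Q < C\<^sub>* |w - w0|\<close> (\<open>rarefaction_flux_drop\<close>,
  \<open>returning_rarefaction_origin\<close>).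

  The assertions on rarefactions whose history matters are instances. If the tree contains
  \<open>\<rho>\<close>-waves only, then \<open>w = w0\<close>. If \<open>S\<close> comes from one contact discontinuity meeting one front from \<open>J\<close>,
  then that front is \<open>f\<close>. In general \<open>w\<close> and \<open>w0\<close> are the values attached to the level of \<open>S\<close> and to
  level 1, and their distance is bounded by telescoping. For shocks the sign of the flux variation
  is the sign of the speed, and for rarefactions whose right density lies between \<open>\<sigma>\<close> and the
  other density of the left state it is read off the increasing branch of the flux.\<close>

section \<open>Calculus on the rectangle\<close>

abbreviation rect :: "model \<Rightarrow> (real \<times> real) set" where
  "rect M \<equiv> {0..rho_sup M} \<times> {w_lo M..w_hi M}"

lemma Ck_on_cong:
  assumes "Ck_on k S f" "\<And>p. p \<in> S \<Longrightarrow> f p = g p"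
  shows "Ck_on k S g"
proof (cases k)
  case 0
  then show ?thesis using assms continuous_on_cong[of S S f g] by simp
next
  case (Suc j)
  with assms(1) obtain f1 f2 where
    "\<forall>p\<in>S. (f has_derivative (\<lambda>h. fst h * f1 p + snd h * f2 p)) (at p within S)"
    "Ck_on j S f1" "Ck_on j S f2" by auto
  moreover have "\<forall>p\<in>S. (g has_derivative (\<lambda>h. fst h * f1 p + snd h * f2 p)) (at p within S)"
    using calculation(1) assms(2) by (auto intro: has_derivative_transform[where f = f])
  ultimately show ?thesis using Suc by auto
qed

text \<open>The coefficients of the total derivative on the rectangle are the one-sided partial derivatives
  \<open>d_rho\<close> and \<open>d_w\<close>, which thereby inherit the remaining smoothness; applied to \<open>d_rho M f\<close> again, this
  gives the second derivative.\<close>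

lemma smooth_partials:
  assumes "Ck_on (Suc k) (rect M) (\<lambda>(r, w). f r w)" "0 < rho_sup M" "w_lo M < w_hi M"
  shows d_rho_deriv: "\<And>r w. (r, w) \<in> rect M \<Longrightarrow>
      ((\<lambda>s. f s w) has_real_derivative d_rho M f r w) (at r within {0..rho_sup M})"
    and d_w_deriv: "\<And>r w. (r, w) \<in> rect M \<Longrightarrow>
      ((\<lambda>v. f r v) has_real_derivative d_w M f r w) (at w within {w_lo M..w_hi M})"
    and Ck_on_d_rho: "Ck_on k (rect M) (\<lambda>(r, w). d_rho M f r w)"
    and Ck_on_d_w: "Ck_on k (rect M) (\<lambda>(r, w). d_w M f r w)"
proof -
  obtain f1 f2 where f: "\<And>p. p \<in> rect M \<Longrightarrow>
      ((\<lambda>(r, w). f r w) has_derivative (\<lambda>h. fst h * f1 p + snd h * f2 p)) (at p within rect M)"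
    and ck: "Ck_on k (rect M) f1" "Ck_on k (rect M) f2"
    using assms(1) by auto
  have 1: "((\<lambda>s. f s w) has_real_derivative f1 (r, w)) (at r within {0..rho_sup M})"
    if "(r, w) \<in> rect M" for r w
  proof -
    have inner: "((\<lambda>s. (s, w)) has_derivative (\<lambda>h. (h, 0))) (at r within {0..rho_sup M})"
      by (auto intro!: derivative_eq_intros)
    have outer: "((\<lambda>(r, w). f r w) has_derivative (\<lambda>h. fst h * f1 (r, w) + snd h * f2 (r, w)))
        (at ((\<lambda>s. (s, w)) r) within (\<lambda>s. (s, w)) ` {0..rho_sup M})"
      by (rule has_derivative_subset[OF f[OF that]]) (use that in auto)
    from has_derivative_in_compose[OF inner outer]
    show ?thesis by (simp add: has_field_derivative_def mult.commute[of _ "f1 (r, w)"])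
  qed
  have 2: "((\<lambda>v. f r v) has_real_derivative f2 (r, w)) (at w within {w_lo M..w_hi M})"
    if "(r, w) \<in> rect M" for r w
  proof -
    have inner: "((\<lambda>v. (r, v)) has_derivative (\<lambda>h. (0, h))) (at w within {w_lo M..w_hi M})"
      by (auto intro!: derivative_eq_intros)
    have outer: "((\<lambda>(r, w). f r w) has_derivative (\<lambda>h. fst h * f1 (r, w) + snd h * f2 (r, w)))
        (at ((\<lambda>v. (r, v)) w) within (\<lambda>v. (r, v)) ` {w_lo M..w_hi M})"
      by (rule has_derivative_subset[OF f[OF that]]) (use that in auto)
    from has_derivative_in_compose[OF inner outer]
    show ?thesis by (simp add: has_field_derivative_def mult.commute[of _ "f2 (r, w)"])
  qed
  have e1: "d_rho M f r w = f1 (r, w)" if "(r, w) \<in> rect M" for r w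
    using vector_derivative_within_cbox[of 0 "rho_sup M" r] 1[OF that] that assms(2)
    by (auto simp: d_rho_def has_real_derivative_iff_has_vector_derivative)
  have e2: "d_w M f r w = f2 (r, w)" if "(r, w) \<in> rect M" for r w
    using vector_derivative_within_cbox[of "w_lo M" "w_hi M" w] 2[OF that] that assms(3)
    by (auto simp: d_w_def has_real_derivative_iff_has_vector_derivative)
  show "((\<lambda>s. f s w) has_real_derivative d_rho M f r w) (at r within {0..rho_sup M})"
    if "(r, w) \<in> rect M" for r w using 1 e1 that by simp
  show "((\<lambda>v. f r v) has_real_derivative d_w M f r w) (at w within {w_lo M..w_hi M})"
    if "(r, w) \<in> rect M" for r w using 2 e2 that by simp
  show "Ck_on k (rect M) (\<lambda>(r, w). d_rho M f r w)"
    by (rule Ck_on_cong[OF ck(1)]) (use e1 in force)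
  show "Ck_on k (rect M) (\<lambda>(r, w). d_w M f r w)"
    by (rule Ck_on_cong[OF ck(2)]) (use e2 in force)
qed

lemma mean_value_within:
  fixes f f' :: "real \<Rightarrow> real"
  assumes der: "\<And>x. x \<in> {A..B} \<Longrightarrow> (f has_real_derivative f' x) (at x within {A..B})"
    and x: "x \<in> {A..B}" and y: "y \<in> {A..B}" and "x < y"
  obtains \<xi> where "x < \<xi>" "\<xi> < y" "f y - f x = f' \<xi> * (y - x)"
proof -
  have "\<exists>\<xi>\<in>{x<..<y}. f y - f x = (\<lambda>h. f' \<xi> * h) (y - x)"
  proof (rule mvt_simple[OF \<open>x < y\<close>])
    fix z assume "x \<le> z" "z \<le> y"
    then have "(f has_real_derivative f' z) (at z within {x..y})"
      using der[of z] x y by (auto elim!: DERIV_subset)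
    then show "(f has_derivative (\<lambda>h. f' z * h)) (at z within {x..y})"
      by (simp add: has_field_derivative_def)
  qed
  with that show ?thesis by auto
qed

lemma mean_value_within_le:
  fixes f f' :: "real \<Rightarrow> real"
  assumes der: "\<And>x. x \<in> {A..B} \<Longrightarrow> (f has_real_derivative f' x) (at x within {A..B})"
    and x: "x \<in> {A..B}" and y: "y \<in> {A..B}"
  obtains \<xi> where "\<xi> \<in> {A..B}" "f y - f x = f' \<xi> * (y - x)"
proof (cases x y rule: linorder_cases)
  case less
  then show ?thesis using mean_value_within[OF der x y] x y that by (metis atLeastAtMost_iff less_le_not_le order_trans)
next
  case equal
  then show ?thesis using that[of x] x by simp
next
  case greater
  obtain \<xi> where "y < \<xi>" "\<xi> < x" "f x - f y = f' \<xi> * (x - y)"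
    using mean_value_within[OF der y x greater] by blast
  then show ?thesis using x y by (intro that[of \<xi>]) (auto simp: algebra_simps)
qed

context
  fixes M :: model
  assumes model: "traffic_model M"
begin

lemma w_range: "w_lo M < w_hi M"
  using model by (simp add: traffic_model_def)

lemma rho_max_bounds:
  assumes "w \<in> {w_lo M..w_hi M}"
  shows "0 < rho_max M w" "rho_max M w \<le> rho_sup M"
  using model assms by (auto simp: traffic_model_def)

lemma rho_sup_pos: "0 < rho_sup M"
  using rho_max_bounds[of "w_lo M"] w_range by auto

lemma flux_ends:
  assumes "w \<in> {w_lo M..w_hi M}"
  shows "flux M 0 w = 0" "flux M (rho_max M w) w = 0"
  using model assms by (auto simp: traffic_model_def)

lemma flux_eq:
  assumes "(r, w) \<in> rect M"
  shows "flux M r w = r * vel M r w"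
proof (cases "r = 0")
  case False
  with assms have "vel M r w = flux M r w / r"
    using model by (auto simp: traffic_model_def)
  with False show ?thesis by simp
qed (use assms flux_ends in auto)

lemma vel_nonneg: "w \<in> {w_lo M..w_hi M} \<Longrightarrow> r \<in> {0..rho_max M w} \<Longrightarrow> 0 \<le> vel M r w"
  using model by (auto simp: traffic_model_def)

lemma vel_rho_max: "w \<in> {w_lo M..w_hi M} \<Longrightarrow> vel M (rho_max M w) w = 0"
  using flux_eq[of "rho_max M w" w] flux_ends[of w] rho_max_bounds[of w] by auto

lemma partials_sign:
  assumes "(r, w) \<in> rect M"
  shows "d_rho M (d_rho M (flux M)) r w < 0" "d_rho M (vel M) r w < 0" "0 \<le> d_w M (vel M) r w"
  using model assms by (auto simp: traffic_model_def)

lemma Ck_vel: "Ck_on k (rect M) (\<lambda>(r, w). vel M r w)"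
  and Ck_flux: "Ck_on k (rect M) (\<lambda>(r, w). flux M r w)"
  using model by (auto simp: traffic_model_def smooth_on_def)

lemmas vel_rho_deriv = d_rho_deriv[OF Ck_vel rho_sup_pos w_range]
lemmas vel_w_deriv = d_w_deriv[OF Ck_vel rho_sup_pos w_range]
lemmas flux_deriv = d_rho_deriv[OF Ck_flux rho_sup_pos w_range]
lemmas flux_deriv2 = d_rho_deriv[OF Ck_on_d_rho[OF Ck_flux rho_sup_pos w_range] rho_sup_pos w_range]

lemma vel_strict_anti:
  assumes "w \<in> {w_lo M..w_hi M}" "r \<in> {0..rho_sup M}" "s \<in> {0..rho_sup M}" "r < s"
  shows "vel M s w < vel M r w"
proof -
  obtain \<xi> where "r < \<xi>" "\<xi> < s" "vel M s w - vel M r w = d_rho M (vel M) \<xi> w * (s - r)"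
    using mean_value_within[OF vel_rho_deriv, of w r s] assms by auto
  moreover have "d_rho M (vel M) \<xi> w < 0"
    using partials_sign(2)[of \<xi> w] assms \<open>r < \<xi>\<close> \<open>\<xi> < s\<close> by auto
  ultimately show ?thesis
    using assms(4) by (smt (verit) mult_neg_pos)
qed

lemma d_rho_flux_strict_anti:
  assumes "w \<in> {w_lo M..w_hi M}" "r \<in> {0..rho_sup M}" "s \<in> {0..rho_sup M}" "r < s"
  shows "d_rho M (flux M) s w < d_rho M (flux M) r w"
proof -
  obtain \<xi> where "r < \<xi>" "\<xi> < s"
    "d_rho M (flux M) s w - d_rho M (flux M) r w = d_rho M (d_rho M (flux M)) \<xi> w * (s - r)"
    using mean_value_within[OF flux_deriv2, of w r s] assms by auto
  moreover have "d_rho M (d_rho M (flux M)) \<xi> w < 0"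
    using partials_sign(1)[of \<xi> w] assms \<open>r < \<xi>\<close> \<open>\<xi> < s\<close> by auto
  ultimately show ?thesis
    using assms(4) by (smt (verit) mult_neg_pos)
qed

text \<open>The form in which concavity enters: it yields the uniqueness of the maximum point and the
  monotonicity of the flux on both sides of it.\<close>

lemma flux_quasiconcave:
  assumes w: "w \<in> {w_lo M..w_hi M}" and "a \<in> {0..rho_sup M}" "c \<in> {0..rho_sup M}" "a < b" "b < c"
  shows "min (flux M a w) (flux M c w) < flux M b w"
proof (rule ccontr)
  assume neg: "\<not> ?thesis"
  have b: "b \<in> {0..rho_sup M}" using assms by auto
  obtain \<xi> where x: "a < \<xi>" "\<xi> < b" "flux M b w - flux M a w = d_rho M (flux M) \<xi> w * (b - a)"
    using mean_value_within[OF flux_deriv, of w a b] assms b by auto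
  obtain \<eta> where y: "b < \<eta>" "\<eta> < c" "flux M c w - flux M b w = d_rho M (flux M) \<eta> w * (c - b)"
    using mean_value_within[OF flux_deriv, of w b c] assms b by auto
  have "d_rho M (flux M) \<eta> w < d_rho M (flux M) \<xi> w"
    using d_rho_flux_strict_anti[OF w, of \<xi> \<eta>] assms x y by auto
  moreover have "d_rho M (flux M) \<xi> w * (b - a) \<le> 0" "0 \<le> d_rho M (flux M) \<eta> w * (c - b)"
    using neg x(3) y(3) by auto
  ultimately show False
    using assms by (smt (verit) mult_pos_pos mult_neg_pos)
qed

lemma flux_continuous: "w \<in> {w_lo M..w_hi M} \<Longrightarrow> continuous_on {0..rho_sup M} (\<lambda>r. flux M r w)"
  by (rule DERIV_continuous_on[OF flux_deriv]) auto

lemma vel_continuous: "w \<in> {w_lo M..w_hi M} \<Longrightarrow> continuous_on {0..rho_sup M} (\<lambda>r. vel M r w)"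
  by (rule DERIV_continuous_on[OF vel_rho_deriv]) auto

section \<open>The maximum point of the flux\<close>

lemma sigma_maximal:
  assumes w: "w \<in> {w_lo M..w_hi M}"
  shows sigma_range: "sigma M w \<in> {0..rho_max M w}"
    and flux_less_max: "\<And>r. r \<in> {0..rho_max M w} \<Longrightarrow> r \<noteq> sigma M w \<Longrightarrow> flux M r w < flux M (sigma M w) w"
proof -
  note b = rho_max_bounds[OF w]
  define P where "P s \<longleftrightarrow> s \<in> {0..rho_max M w} \<and>
    (\<forall>r\<in>{0..rho_max M w}. flux M r w \<le> flux M s w)" for s
  have "continuous_on {0..rho_max M w} (\<lambda>r. flux M r w)"
    by (rule continuous_on_subset[OF flux_continuous[OF w]]) (use b in auto)
  then obtain s where s: "P s"
    using continuous_attains_sup[of "{0..rho_max M w}" "\<lambda>r. flux M r w"] b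
    unfolding P_def by fastforce
  have no: False if "P x" "P y" "x < y" for x y
  proof -
    have "min (flux M x w) (flux M y w) < flux M ((x + y) / 2) w"
      using that b by (intro flux_quasiconcave[OF w]) (auto simp: P_def)
    moreover have "(x + y) / 2 \<in> {0..rho_max M w}"
      using that by (auto simp: P_def)
    then have "flux M ((x + y) / 2) w \<le> flux M x w" "flux M ((x + y) / 2) w \<le> flux M y w"
      using that by (auto simp: P_def)
    ultimately show False by linarith
  qed
  have uniq: "x = s" if "P x" for x
    using no[OF that s] no[OF s that] by (cases x s rule: linorder_cases) auto
  have "sigma M w = s"
    using the_equality[of P, OF s uniq] by (simp add: sigma_def P_def)
  moreover have "flux M r w < flux M s w" if "r \<in> {0..rho_max M w}" "r \<noteq> s" for r
  proof (rule ccontr)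
    assume "\<not> ?thesis"
    then have "P r" using s that(1) unfolding P_def by force
    then show False using uniq that by blast
  qed
  ultimately show "sigma M w \<in> {0..rho_max M w}"
    "\<And>r. r \<in> {0..rho_max M w} \<Longrightarrow> r \<noteq> sigma M w \<Longrightarrow> flux M r w < flux M (sigma M w) w"
    using s by (auto simp: P_def)
qed

lemma flux_increasing:
  assumes w: "w \<in> {w_lo M..w_hi M}" and "0 \<le> a" "a < b" "b \<le> sigma M w"
  shows "flux M a w < flux M b w"
proof (cases "b = sigma M w")
  case True
  then show ?thesis using flux_less_max[OF w, of a] sigma_range[OF w] assms by auto
next
  case False
  have "min (flux M a w) (flux M (sigma M w) w) < flux M b w"
    using assms False sigma_range[OF w] rho_max_bounds[OF w] by (intro flux_quasiconcave[OF w]) auto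
  moreover have "flux M b w < flux M (sigma M w) w"
    using flux_less_max[OF w, of b] sigma_range[OF w] assms False by auto
  ultimately show ?thesis by linarith
qed

lemma flux_decreasing:
  assumes w: "w \<in> {w_lo M..w_hi M}" and "sigma M w \<le> a" "a < b" "b \<le> rho_max M w"
  shows "flux M b w < flux M a w"
proof (cases "a = sigma M w")
  case True
  then show ?thesis using flux_less_max[OF w, of b] sigma_range[OF w] assms by auto
next
  case False
  have "min (flux M (sigma M w) w) (flux M b w) < flux M a w"
    using assms False sigma_range[OF w] rho_max_bounds[OF w] by (intro flux_quasiconcave[OF w]) auto
  moreover have "flux M a w < flux M (sigma M w) w"
    using flux_less_max[OF w, of a] sigma_range[OF w] assms False by auto
  ultimately show ?thesis by linarith
qed

lemma flux_nonneg: "w \<in> {w_lo M..w_hi M} \<Longrightarrow> r \<in> {0..rho_max M w} \<Longrightarrow> 0 \<le> flux M r w"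
  using flux_eq[of r w] vel_nonneg[of w r] rho_max_bounds[of w] by auto

lemma other_density_left:
  assumes w: "w \<in> {w_lo M..w_hi M}" and r: "r < sigma M w" "0 \<le> r"
  shows "sigma M w < other_density M r w"
proof -
  note s = sigma_range[OF w] and b = rho_max_bounds[OF w]
  have "\<exists>x\<ge>sigma M w. x \<le> rho_max M w \<and> flux M x w = flux M r w"
  proof (rule IVT2')
    show "continuous_on {sigma M w..rho_max M w} (\<lambda>x. flux M x w)"
      by (rule continuous_on_subset[OF flux_continuous[OF w]]) (use b s in auto)
  qed (use flux_ends[OF w] flux_nonneg[OF w, of r] flux_less_max[OF w, of r] r s in auto)
  then obtain x where x: "sigma M w \<le> x" "x \<le> rho_max M w" "flux M x w = flux M r w" by blast
  have ne: "x \<noteq> sigma M w" using x flux_less_max[OF w, of r] r s by auto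
  have "other_density M r w = x"
    unfolding other_density_def
  proof (rule the_equality)
    show "x \<in> {0..rho_max M w} \<and> flux M x w = flux M r w \<and> (x = r \<longleftrightarrow> r = sigma M w)"
      using x r s by auto
    fix y assume y: "y \<in> {0..rho_max M w} \<and> flux M y w = flux M r w \<and> (y = r \<longleftrightarrow> r = sigma M w)"
    then have "\<not> y \<le> sigma M w"
      using flux_increasing[OF w, of y r] flux_increasing[OF w, of r y] r by force
    then show "y = x"
      using flux_decreasing[OF w, of y x] flux_decreasing[OF w, of x y] x y by force
  qed
  with x ne show ?thesis by simp
qed

lemma other_density_sigma:
  assumes w: "w \<in> {w_lo M..w_hi M}"
  shows "other_density M (sigma M w) w = sigma M w"
  unfolding other_density_def
  by (rule the_equality) (use sigma_range[OF w] in auto)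

lemma other_density_right:
  assumes w: "w \<in> {w_lo M..w_hi M}" and r: "sigma M w < r" "r \<le> rho_max M w"
  shows "0 \<le> other_density M r w" "flux M (other_density M r w) w = flux M r w"
proof -
  note s = sigma_range[OF w] and b = rho_max_bounds[OF w]
  have "\<exists>x\<ge>0. x \<le> sigma M w \<and> flux M x w = flux M r w"
  proof (rule IVT')
    show "continuous_on {0..sigma M w} (\<lambda>x. flux M x w)"
      by (rule continuous_on_subset[OF flux_continuous[OF w]]) (use b s in auto)
  qed (use flux_ends[OF w] flux_nonneg[OF w, of r] flux_less_max[OF w, of r] r s in auto)
  then obtain x where x: "0 \<le> x" "x \<le> sigma M w" "flux M x w = flux M r w" by blast
  have "other_density M r w = x"
    unfolding other_density_def
  proof (rule the_equality)
    show "x \<in> {0..rho_max M w} \<and> flux M x w = flux M r w \<and> (x = r \<longleftrightarrow> r = sigma M w)"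
      using x r s by auto
    fix y assume y: "y \<in> {0..rho_max M w} \<and> flux M y w = flux M r w \<and> (y = r \<longleftrightarrow> r = sigma M w)"
    then have "\<not> sigma M w \<le> y"
      using flux_decreasing[OF w, of y r] flux_decreasing[OF w, of r y] r by force
    then show "y = x"
      using flux_increasing[OF w, of y x] flux_increasing[OF w, of x y] x y by force
  qed
  with x show "0 \<le> other_density M r w" "flux M (other_density M r w) w = flux M r w" by simp_all
qed

section \<open>Flux variation along velocity level curves\<close>

text \<open>The supremum in \<open>C_star\<close> is finite, as the expression is continuous on a compact box;
  it is continuous because \<open>V\<^sub>\<rho>\<close> does not vanish.\<close>

lemma C_star_upper:
  assumes "(r, w) \<in> rect M" "(r', w') \<in> rect M" "r'' \<in> {0..rho_sup M}"
  shows "(- (d_w M (vel M) r w / d_rho M (vel M) r' w')) * vel M r'' w' \<le> C_star M / 2"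
proof -
  let ?X = "{0..rho_sup M} \<times> {0..rho_sup M} \<times> {0..rho_sup M} \<times>
    {w_lo M..w_hi M} \<times> {w_lo M..w_hi M}"
  let ?F = "\<lambda>(r, r', r'', w, w'). (- (d_w M (vel M) r w / d_rho M (vel M) r' w')) * vel M r'' w'"
  have c: "continuous_on (rect M) (\<lambda>(r, w). vel M r w)"
    "continuous_on (rect M) (\<lambda>(r, w). d_rho M (vel M) r w)"
    "continuous_on (rect M) (\<lambda>(r, w). d_w M (vel M) r w)"
    using Ck_vel[of 0] Ck_on_d_rho[OF Ck_vel rho_sup_pos w_range, where k = 0]
      Ck_on_d_w[OF Ck_vel rho_sup_pos w_range, where k = 0] by simp_all
  have "continuous_on ?X ?F"
    unfolding case_prod_unfold
  proof (intro continuous_on_mult continuous_on_minus continuous_on_divide)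
    have "continuous_on ?X (\<lambda>p. (\<lambda>(r, w). d_w M (vel M) r w) (fst p, fst (snd (snd (snd p)))))"
      by (rule continuous_on_compose2[OF c(3)]) (auto intro!: continuous_intros)
    then show "continuous_on ?X (\<lambda>p. d_w M (vel M) (fst p) (fst (snd (snd (snd p)))))"
      by simp
    have "continuous_on ?X (\<lambda>p. (\<lambda>(r, w). d_rho M (vel M) r w) (fst (snd p), snd (snd (snd (snd p)))))"
      by (rule continuous_on_compose2[OF c(2)]) (auto intro!: continuous_intros)
    then show "continuous_on ?X (\<lambda>p. d_rho M (vel M) (fst (snd p)) (snd (snd (snd (snd p)))))"
      by simp
    show "\<forall>p\<in>?X. d_rho M (vel M) (fst (snd p)) (snd (snd (snd (snd p)))) \<noteq> 0"
    proof
      fix p assume "p \<in> ?X"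
      then have "(fst (snd p), snd (snd (snd (snd p)))) \<in> rect M" by auto
      from partials_sign(2)[OF this]
      show "d_rho M (vel M) (fst (snd p)) (snd (snd (snd (snd p)))) \<noteq> 0" by simp
    qed
    have "continuous_on ?X (\<lambda>p. (\<lambda>(r, w). vel M r w) (fst (snd (snd p)), snd (snd (snd (snd p)))))"
      by (rule continuous_on_compose2[OF c(1)]) (auto intro!: continuous_intros)
    then show "continuous_on ?X (\<lambda>p. vel M (fst (snd (snd p))) (snd (snd (snd (snd p)))))"
      by simp
  qed
  then have "bdd_above (?F ` ?X)"
    by (intro bounded_imp_bdd_above compact_imp_bounded compact_continuous_image compact_Times compact_Icc)
  then have "?F (r, r', r'', w, w') \<le> (SUP p\<in>?X. ?F p)"
    by (rule cSUP_upper2[of _ _ "(r, r', r'', w, w')"]) (use assms in auto)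
  then show ?thesis by (simp add: C_star_def)
qed

text \<open>On a level curve of \<open>V\<close> the density has the derivative \<open>- V\<^sub>w / V\<^sub>\<rho>\<close> with respect to \<open>w\<close>. Instead of
  parametrizing the curve, one splits \<open>V(a, w1) = V(b, w2)\<close> at the corner \<open>(b, w1)\<close> and applies
  the mean value theorem on each leg; this is why \<open>V\<^sub>w\<close> and \<open>V\<^sub>\<rho>\<close> are evaluated at different
  points in \<open>C_star\<close>. The factor \<open>V\<close> turns densities into fluxes.\<close>

lemma level_curve_bound:
  assumes a: "(a, w1) \<in> rect M" and b: "(b, w2) \<in> rect M"
    and v: "vel M a w1 = vel M b w2" "0 \<le> vel M a w1"
  shows "\<bar>a - b\<bar> * vel M a w1 \<le> C_star M / 2 * \<bar>w1 - w2\<bar>"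
proof -
  obtain \<eta> where \<eta>: "\<eta> \<in> {w_lo M..w_hi M}"
    "vel M b w2 - vel M b w1 = d_w M (vel M) b \<eta> * (w2 - w1)"
    using mean_value_within_le[OF vel_w_deriv, of b w1 w2] a b by auto
  obtain \<xi> where \<xi>: "\<xi> \<in> {0..rho_sup M}"
    "vel M a w1 - vel M b w1 = d_rho M (vel M) \<xi> w1 * (a - b)"
    using mean_value_within_le[OF vel_rho_deriv, of w1 b a] a b by auto
  let ?q = "- (d_w M (vel M) b \<eta> / d_rho M (vel M) \<xi> w1)"
  have neg: "d_rho M (vel M) \<xi> w1 < 0" and pos: "0 \<le> d_w M (vel M) b \<eta>"
    using partials_sign(2)[of \<xi> w1] partials_sign(3)[of b \<eta>] \<xi> \<eta> a b by auto
  have "a - b = ?q * (w1 - w2)"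
    using \<xi>(2) \<eta>(2) v(1) neg by (simp add: field_simps)
  moreover have "0 \<le> ?q" using neg pos by (simp add: divide_nonneg_neg)
  ultimately have "\<bar>a - b\<bar> = ?q * \<bar>w1 - w2\<bar>" by (metis abs_mult abs_of_nonneg)
  then have "\<bar>a - b\<bar> * vel M a w1 = (?q * vel M a w1) * \<bar>w1 - w2\<bar>" by (simp add: mult_ac)
  also have "\<dots> \<le> C_star M / 2 * \<bar>w1 - w2\<bar>"
    by (intro mult_right_mono C_star_upper) (use a b \<xi> \<eta> in auto)
  finally show ?thesis .
qed

lemma density_of_velocity:
  assumes w: "w \<in> {w_lo M..w_hi M}" and r: "r \<in> {0..rho_max M w}" and v: "0 \<le> v" "v \<le> vel M r w"
  obtains s where "s \<in> {r..rho_max M w}" "vel M s w = v"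
proof -
  have "\<exists>s\<ge>r. s \<le> rho_max M w \<and> vel M s w = v"
  proof (rule IVT2')
    show "continuous_on {r..rho_max M w} (\<lambda>s. vel M s w)"
      by (rule continuous_on_subset[OF vel_continuous[OF w]]) (use rho_max_bounds[OF w] r in auto)
  qed (use v r vel_rho_max[OF w] in auto)
  with that show ?thesis by auto
qed

text \<open>The central estimate. The densities \<open>a0\<close> and \<open>b0\<close> below have the velocities of the two given states
  on the line \<open>w0\<close>; there the congested state \<open>r\<close> bounds them from below, so the flux is
  decreasing between them. Changing back from \<open>w0\<close> to \<open>w\<close> costs half of \<open>C_star\<close> for each state.\<close>

lemma rarefaction_flux_drop:
  assumes r: "(r, w0) \<in> states M" "sigma M w0 \<le> r"
    and a: "(a, w) \<in> states M" and b: "(b, w) \<in> states M" and "b < a"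
    and v: "vel M b w \<le> vel M r w0"
  shows "flux M a w - flux M b w < C_star M * \<bar>w - w0\<bar>"
proof -
  have w: "w \<in> {w_lo M..w_hi M}" and w0: "w0 \<in> {w_lo M..w_hi M}"
    and ranges: "r \<in> {0..rho_max M w0}" "a \<in> {0..rho_max M w}" "b \<in> {0..rho_max M w}"
    using r a b by (auto simp: states_def)
  note m = rho_max_bounds(2)[OF w] and m0 = rho_max_bounds(2)[OF w0]
  have va: "0 \<le> vel M a w" and vb: "0 \<le> vel M b w"
    using vel_nonneg[OF w] ranges by auto
  have ab: "vel M a w < vel M b w"
    using vel_strict_anti[OF w, of b a] ranges m \<open>b < a\<close> by auto
  obtain b0 where b0: "b0 \<in> {r..rho_max M w0}" "vel M b0 w0 = vel M b w"
    using density_of_velocity[OF w0 ranges(1) vb v] by blast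
  then have b0r: "b0 \<in> {0..rho_max M w0}" using ranges by auto
  obtain a0 where a0: "a0 \<in> {b0..rho_max M w0}" "vel M a0 w0 = vel M a w"
    using density_of_velocity[OF w0 b0r va] b0 ab by auto
  have "b0 < a0" using a0 b0 ab by (cases "a0 = b0") auto
  then have "flux M a0 w0 < flux M b0 w0"
    using flux_decreasing[OF w0, of b0 a0] r(2) b0 a0 by auto
  then have 1: "a0 * vel M a w < b0 * vel M b w"
    using flux_eq[of a0 w0] flux_eq[of b0 w0] a0 b0 b0r w0 m0 by auto
  have "\<bar>a - a0\<bar> * vel M a w \<le> C_star M / 2 * \<bar>w - w0\<bar>"
    by (rule level_curve_bound) (use a0 b0r ranges w w0 m m0 va in auto)
  moreover have "(a - a0) * vel M a w \<le> \<bar>a - a0\<bar> * vel M a w"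
    using va by (intro mult_right_mono) auto
  ultimately have 2: "(a - a0) * vel M a w \<le> C_star M / 2 * \<bar>w - w0\<bar>" by linarith
  have "\<bar>b - b0\<bar> * vel M b w \<le> C_star M / 2 * \<bar>w - w0\<bar>"
    by (rule level_curve_bound) (use b0 b0r ranges w w0 m m0 vb in auto)
  moreover have "(b0 - b) * vel M b w \<le> \<bar>b - b0\<bar> * vel M b w"
    using vb by (intro mult_right_mono) auto
  ultimately have 3: "(b0 - b) * vel M b w \<le> C_star M / 2 * \<bar>w - w0\<bar>" by linarith
  have "flux M a w - flux M b w = a * vel M a w - b * vel M b w"
    using flux_eq[of a w] flux_eq[of b w] ranges w m by auto
  with 1 2 3 show ?thesis by (simp add: algebra_simps)
qed

end

section \<open>Chains of fronts\<close>

lemma chain_append: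
  "chain U (fs @ gs) U' \<longleftrightarrow> (\<exists>U''. chain U fs U'' \<and> chain U'' gs U')"
  by (induction fs arbitrary: U) auto

lemma chain_invariant:
  assumes "chain U fs U'" "\<forall>f\<in>set fs. F (lst f) = F (rst f)"
  shows "F U' = F U" "\<forall>f\<in>set fs. F (lst f) = F U \<and> F (rst f) = F U"
proof -
  have "F U' = F U \<and> (\<forall>f\<in>set fs. F (lst f) = F U \<and> F (rst f) = F U)"
    using assms
  proof (induction fs arbitrary: U)
    case (Cons f fs)
    from Cons.IH[of "rst f"] Cons.prems
    have "F U' = F (rst f)" "\<forall>g\<in>set fs. F (lst g) = F (rst f) \<and> F (rst g) = F (rst f)"
      "F (rst f) = F (lst f)" "U = lst f" by simp_all
    then show ?case by simp
  qed simp
  then show "F U' = F U" "\<forall>f\<in>set fs. F (lst f) = F U \<and> F (rst f) = F U" by blast+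
qed

lemma chain_decreasing:
  fixes F :: "state \<Rightarrow> real"
  assumes "chain U fs U'" "\<forall>f\<in>set fs. F (rst f) \<le> F (lst f)"
  shows "\<forall>f\<in>set fs. F U' \<le> F (rst f)"
proof -
  have "F U' \<le> F U \<and> (\<forall>f\<in>set fs. F U' \<le> F (rst f))"
    using assms
  proof (induction fs arbitrary: U)
    case (Cons f fs)
    from Cons.IH[of "rst f"] Cons.prems have "F U' \<le> F (rst f)" "\<forall>g\<in>set fs. F U' \<le> F (rst g)"
      "lst f = U" "F (rst f) \<le> F (lst f)" by simp_all
    then show ?case by auto
  qed simp
  then show ?thesis by simp
qed

lemma wave_branch_subset_tree: "g \<in> wave_branch D f \<Longrightarrow> g \<in> wave_tree D f"
  by (induction rule: wave_branch.induct) (auto intro: wave_tree.intros)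

lemma wave_branch_fam: "g \<in> wave_branch D f \<Longrightarrow> fam g = fam f"
  by (induction rule: wave_branch.induct) auto

lemma wave_branch_first_step:
  assumes "g \<in> wave_branch D f"
  shows "g = f \<or> (\<exists>h\<in>parents D f. fam h = fam f \<and> g \<in> wave_branch D h)"
  using assms
proof (induction rule: wave_branch.induct)
  case (parent h g)
  then show ?case by (metis wave_branch.intros wave_branch_fam)
qed simp

lemma parents_interior: "g \<in> parents D f \<Longrightarrow> interior_pt D (x_start f)"
  by (auto simp: parents_def split: if_splits)

lemma parents_end:
  "g \<in> parents D f \<Longrightarrow> g \<in> fronts D \<and> x_end g = x_start f \<and> t_end g = t_start f"
  by (auto simp: parents_def ending_at_def split: if_splits)

lemma pos_start: "pos f (t_start f) = x_start f"
  by (simp add: pos_def)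

lemma pos_end: "pos f (t_end f) = x_end f"
  by (simp add: x_end_def)

lemma pos_continuous: "continuous_on A (pos f)"
  unfolding pos_def by (intro continuous_intros)

lemma pos_from_end: "pos f t = x_end f - speed f * (t_end f - t)"
  by (simp add: x_end_def pos_def algebra_simps)

text \<open>Going back to a parent strictly lowers the rank, so the rank serves as a measure for backward
  tracing and as a bound for the levels.\<close>

definition rank :: "road \<Rightarrow> front \<Rightarrow> nat" where
  "rank D f = card {h \<in> fronts D. t_start h < t_start f}"

context
  fixes M :: model and D :: road
  assumes model: "traffic_model M" and road: "incoming_wft M D"
begin

lemmas finite_fronts = road[unfolded incoming_wft_def, THEN conjunct2, THEN conjunct2, THEN conjunct1]
lemmas front_conditions = road[unfolded incoming_wft_def, THEN conjunct2, THEN conjunct2, THEN conjunct2, THEN conjunct1]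
lemmas meeting_condition = road[unfolded incoming_wft_def, THEN conjunct2, THEN conjunct2, THEN conjunct2, THEN conjunct2, THEN conjunct1]
lemmas point_condition = road[unfolded incoming_wft_def, THEN conjunct2, THEN conjunct2, THEN conjunct2, THEN conjunct2, THEN conjunct2, THEN conjunct1]
lemmas emission_condition = road[unfolded incoming_wft_def, THEN conjunct2, THEN conjunct2, THEN conjunct2, THEN conjunct2, THEN conjunct2, THEN conjunct2]

lemma front_wave: "f \<in> fronts D \<Longrightarrow> rho_wave M f \<or> w_wave M f"
  and front_states: "f \<in> fronts D \<Longrightarrow> lst f \<in> states M \<and> rst f \<in> states M"
  and front_times: "f \<in> fronts D \<Longrightarrow> 0 \<le> t_start f \<and> t_start f < t_end f \<and> t_end f \<le> horizon D"
  and front_interior: "f \<in> fronts D \<Longrightarrow> t_start f < t \<Longrightarrow> t < t_end f \<Longrightarrow> interior_pt D (pos f t)"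
  by (drule bspec[OF front_conditions], elim conjE, (intro conjI)?, (assumption | blast)+)+

lemma rho_front: "f \<in> fronts D \<Longrightarrow> fam f = Rho_family \<Longrightarrow> rho_wave M f"
  using front_wave[of f] by (auto simp: w_wave_def)

lemma w_front: "f \<in> fronts D \<Longrightarrow> fam f = W_family \<Longrightarrow> w_wave M f"
  using front_wave[of f] by (auto simp: rho_wave_def)

lemma fronts_meet:
  assumes "f \<in> fronts D" "g \<in> fronts D" "t_start f < t" "t < t_end f"
    "t_start g \<le> t" "t \<le> t_end g" "pos f t = pos g t"
  shows "t_start g < t \<and> t < t_end g \<and> speed f = speed g"
  by (rule meeting_condition[THEN bspec, OF assms(1), THEN bspec, OF assms(2), THEN spec, THEN mp])
    (intro conjI assms)

lemma interaction_at:
  assumes "interior_pt D x" "0 < t" "t < horizon D" "f \<in> ending_at D x t \<union> starting_at D x t"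
  shows "interaction D x t"
  using point_condition[THEN spec, THEN spec, THEN mp, OF conjI[OF assms(1) conjI[OF assms(2,3)]],
      THEN conjunct2, THEN conjunct2, THEN conjunct2, THEN mp] assms(4)
  by blast

lemma passing_families:
  assumes "interior_pt D x" "0 < t" "t < horizon D" "passing_at D x t \<noteq> {}"
  obtains fs where "distinct fs" "set fs = passing_at D x t"
    "map fam fs \<in> {[Rho_family], [W_family], [Rho_family, W_family]}"
proof -
  note at = point_condition[THEN spec, THEN spec, THEN mp, OF conjI[OF assms(1) conjI[OF assms(2,3)]],
      THEN conjunct2, THEN conjunct2, THEN conjunct1, THEN mp, OF assms(4)]
  show thesis by (rule exE[OF at], elim exE conjE, rule that)
qed

lemma emission_at: "0 \<le> t \<Longrightarrow> t < horizon D \<Longrightarrow> emission M D t"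
  by (rule emission_condition[THEN spec, THEN mp]) simp

lemma rank_parent:
  assumes "g \<in> parents D f"
  shows "rank D g < rank D f"
proof -
  have g: "g \<in> fronts D" "t_start g < t_start f"
    using parents_end[OF assms] front_times[of g] by auto
  have "{h \<in> fronts D. t_start h < t_start g} \<subset> {h \<in> fronts D. t_start h < t_start f}"
    using g by force
  then show ?thesis
    unfolding rank_def by (intro psubset_card_mono) (use finite_fronts in auto)
qed

lemma wave_tree_fronts: "g \<in> wave_tree D f \<Longrightarrow> f \<in> fronts D \<Longrightarrow> g \<in> fronts D"
  by (induction rule: wave_tree.induct) (auto dest: parents_end)

lemma wave_branch_earlier: "g \<in> wave_branch D f \<Longrightarrow> t_start g \<le> t_start f"
proof (induction rule: wave_branch.induct)
  case (parent h g)
  then show ?case using parents_end[OF parent(2)] front_times[of g] by auto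
qed simp

text \<open>A front with parents starts strictly inside the road and after time 0, so that the interaction
  condition is available at its starting point.\<close>

lemma parents_interaction:
  assumes "f \<in> fronts D" "g \<in> parents D f"
  shows "interaction D (x_start f) (t_start f)"
    and "parents D f = ending_at D (x_start f) (t_start f)"
    and "f \<in> starting_at D (x_start f) (t_start f)"
proof -
  have g: "g \<in> fronts D" "t_end g = t_start f" "interior_pt D (x_start f)"
    using parents_end[OF assms(2)] parents_interior[OF assms(2)] by auto
  show s: "f \<in> starting_at D (x_start f) (t_start f)"
    using assms(1) by (simp add: starting_at_def)
  show "interaction D (x_start f) (t_start f)"
    by (rule interaction_at[of _ _ f]) (use s g front_times[of g] front_times[of f] assms in auto)
  show "parents D f = ending_at D (x_start f) (t_start f)"
    using g by (simp add: parents_def)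
qed

section \<open>Trajectories of fronts of the first family\<close>

text \<open>Two fronts that travel together are of different families, so a common position
  identifies a front of the first family.\<close>

lemma rho_fronts_disjoint:
  assumes f: "f \<in> fronts D" "fam f = Rho_family" "t_start f < t" "t < t_end f"
    and g: "g \<in> fronts D" "fam g = Rho_family" "t_start g < t" "t < t_end g"
    and eq: "pos f t = pos g t"
  shows "f = g"
proof -
  have p: "f \<in> passing_at D (pos f t) t" "g \<in> passing_at D (pos f t) t"
    using f g eq by (auto simp: passing_at_def)
  obtain fs where fs: "set fs = passing_at D (pos f t) t"
    "map fam fs \<in> {[Rho_family], [W_family], [Rho_family, W_family]}"
    using passing_families[of "pos f t" t] front_interior[OF f(1,3,4)] front_times[OF f(1)] f p
    by (metis empty_iff order_le_less_trans order_less_le_trans)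
  have "f \<in> set fs" "g \<in> set fs" using fs p by auto
  with fs(2) f(2) g(2) show ?thesis
    by (auto simp: map_eq_Cons_conv)
qed

text \<open>The distance of two fronts of the first family is continuous and can vanish only at the ends of their common
  lifetime; hence, going back in time, the order of their positions is preserved.\<close>

lemma stays_right:
  assumes p: "p \<in> fronts D" "fam p = Rho_family" and g: "g \<in> fronts D" "fam g = Rho_family"
    and s: "t_start p < s" "s \<le> t_end p" "t_start g < s" "s \<le> t_end g"
    and right: "pos g s < pos p s"
    and t: "t_start p \<le> t" "t_start g \<le> t" "t < s"
  shows "pos g t \<le> pos p t"
proof (rule ccontr)
  assume neg: "\<not> ?thesis"
  \<comment> \<open>Otherwise the fronts meet at some time strictly between \<open>t\<close> and \<open>s\<close>.\<close>
  have "\<exists>u\<ge>t. u \<le> s \<and> pos p u - pos g u = 0"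
    by (rule IVT') (use neg right t in \<open>auto intro!: continuous_on_diff pos_continuous\<close>)
  then obtain u where u: "t \<le> u" "u \<le> s" "pos p u = pos g u" by auto
  with neg right have "t < u" "u < s" by (metis less_le order_refl)+
  then have "p = g"
    using u s t by (intro rho_fronts_disjoint[OF p _ _ g]) auto
  with right show False by simp
qed

text \<open>Fronts that do not start simultaneously are apart even at the later of the two starting times, which
  \<open>t\<close> may be: one of them is then in the interior of its lifetime, where it cannot be touched by an
  end point of another front.\<close>

lemma strictly_right_of_start:
  assumes p: "p \<in> fronts D" "fam p = Rho_family" and g: "g \<in> fronts D" "fam g = Rho_family"
    and s: "t_start p < s" "s \<le> t_end p" "t_start g < s" "s \<le> t_end g"
    and right: "pos g s < pos p s"
    and t: "t_start p \<le> t" "t_start g \<le> t" "t < s" "t_start p \<noteq> t_start g"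
  shows "pos g t < pos p t"
proof -
  have "pos g t \<noteq> pos p t"
  proof
    assume eq: "pos g t = pos p t"
    have "t_start g < t \<or> t_start p < t" using t by linarith
    then have "t_start g < t \<and> t_start p < t"
      using fronts_meet[OF g(1) p(1), of t] fronts_meet[OF p(1) g(1), of t] s t eq by auto
    then have "g = p" using s t eq by (intro rho_fronts_disjoint[OF g _ _ p]) auto
    with right show False by simp
  qed
  with stays_right[OF p g s right t(1-3)] show ?thesis by simp
qed

lemma start_le_junction:
  assumes f: "f \<in> fronts D"
  shows "x_start f \<le> junction D"
proof (rule ccontr)
  assume neg: "\<not> ?thesis"
  define m where "m = (t_start f + t_end f) / 2"
  have m: "t_start f < m" "m < t_end f" using front_times[OF f] by (auto simp: m_def)
  have "pos f m < junction D"
    using front_interior[OF f m] by (simp add: interior_pt_def)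
  then have "\<exists>u\<ge>t_start f. u \<le> m \<and> pos f u = (junction D + x_start f) / 2"
    by (intro IVT2') (use neg m in \<open>auto simp: pos_start intro!: pos_continuous\<close>)
  then obtain u where u: "t_start f \<le> u" "u \<le> m" "pos f u = (junction D + x_start f) / 2" by auto
  then have "t_start f < u" using neg pos_start[of f] by (cases "u = t_start f") auto
  then show False
    using front_interior[OF f, of u] u m neg by (auto simp: interior_pt_def)
qed

text \<open>A front is to the left of the junction until it ends there.\<close>

lemma reaching_junction_speed_pos:
  assumes f: "f \<in> fronts D" "x_end f = junction D"
  shows "0 < speed f"
proof -
  define m where "m = (t_start f + t_end f) / 2"
  have m: "t_start f < m" "m < t_end f" using front_times[OF f(1)] by (auto simp: m_def)
  have "pos f m < junction D"
    using front_interior[OF f(1) m] by (simp add: interior_pt_def)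
  then have "0 < speed f * (t_end f - m)"
    using pos_from_end[of f m] f(2) by simp
  then show ?thesis using m by (simp add: zero_less_mult_iff)
qed

section \<open>The rightmost front entering an interaction\<close>

text \<open>Since the contact discontinuity that may close a fan keeps \<open>V\<close>, the \<open>\<rho>\<close>-part of the fan ends in a state with the
  velocity of the right state of the fan.\<close>

lemma riemann_fan_rho_part:
  assumes "riemann_fan Ul gs Ur" "set gs \<subseteq> fronts D"
  obtains rs Um where "chain Ul rs Um" "{g \<in> set gs. fam g = Rho_family} = set rs"
    "length rs \<le> 1 \<or> (\<forall>g\<in>set rs. rarefaction g)"
    "vel M (fst Um) (snd Um) = vel M (fst Ur) (snd Ur)"
    "(\<forall>g\<in>set gs. fam g = Rho_family) \<longrightarrow> Um = Ur"
proof -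
  obtain rs ws where gs: "gs = rs @ ws" "chain Ul gs Ur" "\<forall>g\<in>set rs. fam g = Rho_family"
    "length rs \<le> 1 \<or> (\<forall>g\<in>set rs. rarefaction g)" "\<forall>g\<in>set ws. fam g = W_family"
    using assms(1) by (auto simp: riemann_fan_def)
  then obtain Um where c: "chain Ul rs Um" "chain Um ws Ur" by (auto simp: chain_append)
  have "\<forall>g\<in>set ws. vel M (fst (lst g)) (snd (lst g)) = vel M (fst (rst g)) (snd (rst g))"
  proof
    fix g assume "g \<in> set ws"
    then have "w_wave M g" using gs assms(2) by (intro w_front) auto
    then show "vel M (fst (lst g)) (snd (lst g)) = vel M (fst (rst g)) (snd (rst g))"
      by (simp add: w_wave_def)
  qed
  then have "vel M (fst Um) (snd Um) = vel M (fst Ur) (snd Ur)"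
    using chain_invariant(1)[OF c(2), of "\<lambda>U. vel M (fst U) (snd U)"] by simp
  moreover have "Um = Ur" if "\<forall>g\<in>set gs. fam g = Rho_family"
  proof -
    have "ws = []" using that gs by (cases ws) auto
    then show ?thesis using c by simp
  qed
  ultimately show ?thesis using that[OF c(1)] gs by force
qed

lemma rho_fan_decreasing:
  assumes "set rs \<subseteq> fronts D" "\<forall>g\<in>set rs. rarefaction g" "chain Ul rs Um"
  shows "\<forall>g\<in>set rs. snd (rst g) = snd Um \<and> fst Um \<le> fst (rst g)"
proof -
  have "\<forall>g\<in>set rs. snd (lst g) = snd (rst g)"
    using assms rho_front by (auto simp: rarefaction_def rho_wave_def)
  from chain_invariant[OF assms(3) this]
    chain_decreasing[OF assms(3), of fst] assms(2)
  show "\<forall>g\<in>set rs. snd (rst g) = snd Um \<and> fst Um \<le> fst (rst g)"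
    by (auto simp: rarefaction_def less_imp_le)
qed

text \<open>A single \<open>\<rho>\<close>-front of the fan ends at the velocity of the right state. In a fan of rarefactions the
  velocity increases from left to right, so a front that is not the last one ends at a smaller velocity.\<close>

lemma fan_right_velocity:
  assumes "riemann_fan Ul gs Ur" "set gs \<subseteq> fronts D" "h \<in> set gs" "fam h = Rho_family"
  shows "vel M (fst (rst h)) (snd (rst h)) \<le> vel M (fst Ur) (snd Ur)"
proof -
  obtain rs Um where rs: "chain Ul rs Um" "{g \<in> set gs. fam g = Rho_family} = set rs"
    "length rs \<le> 1 \<or> (\<forall>g\<in>set rs. rarefaction g)"
    "vel M (fst Um) (snd Um) = vel M (fst Ur) (snd Ur)"
    by (rule riemann_fan_rho_part[OF assms(1,2)])
  have h: "h \<in> set rs" using assms rs(2) by auto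
  have sub: "set rs \<subseteq> fronts D" using rs(2) assms(2) by auto
  show ?thesis
  proof (cases "length rs \<le> 1")
    case True
    then have "rs = [h]" using h by (cases rs) auto
    then show ?thesis using rs by simp
  next
    case False
    then have all: "\<forall>g\<in>set rs. rarefaction g" using rs by simp
    from rho_fan_decreasing[OF sub all rs(1)] h
    have le: "snd (rst h) = snd Um" "fst Um \<le> fst (rst h)" by auto
    have last: "last rs \<in> set rs" "rst (last rs) = Um"
    proof -
      show "last rs \<in> set rs" using h by (cases rs) auto
      from h have "rs = butlast rs @ [last rs]" by (cases rs) auto
      with rs(1) have "chain Ul (butlast rs @ [last rs]) Um" by simp
      then show "rst (last rs) = Um" by (auto simp: chain_append)
    qed
    have st: "Um \<in> states M" "rst h \<in> states M"
      using front_states[of "last rs"] front_states[of h] last h sub by auto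
    have w: "snd Um \<in> {w_lo M..w_hi M}" using st by (auto simp: states_def)
    have "fst Um \<in> {0..rho_sup M}" "fst (rst h) \<in> {0..rho_sup M}"
      using st le rho_max_bounds(2)[OF model w] by (auto simp: states_def)
    then have "vel M (fst (rst h)) (snd Um) \<le> vel M (fst Um) (snd Um)"
      using vel_strict_anti[OF model w, of "fst Um" "fst (rst h)"] le
      by (cases "fst Um = fst (rst h)") auto
    then show ?thesis using le rs(4) by simp
  qed
qed

text \<open>Contact discontinuities alone cannot meet: neighbouring ones have equal velocities and hence equal speeds.
  So there is a last incoming \<open>\<rho>\<close>-front \<open>p\<close>. To its right there are only contact discontinuities, which
  carry its right velocity to the right end of the interaction. Being last it has the smallest
  speed, so shortly before the interaction it is the rightmost of the incoming
  \<open>\<rho>\<close>-fronts.\<close>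

lemma rightmost_rho_parent:
  assumes h: "h \<in> fronts D" "fam h = Rho_family" and k: "k \<in> parents D h"
  obtains p where "p \<in> parents D h" "fam p = Rho_family"
    "vel M (fst (rst h)) (snd (rst h)) \<le> vel M (fst (rst p)) (snd (rst p))"
    "\<And>g. g \<in> parents D h \<Longrightarrow> fam g = Rho_family \<Longrightarrow> g \<noteq> p \<Longrightarrow> speed p < speed g"
proof -
  note par = parents_interaction[OF h(1) k]
  obtain Ul Ur fs gs where fs: "set fs = parents D h" "chain Ul fs Ur"
      "sorted_wrt (\<lambda>f g. speed g \<le> speed f) fs" "\<exists>f\<in>set fs. \<exists>g\<in>set fs. speed f \<noteq> speed g"
    and gs: "set gs = starting_at D (x_start h) (t_start h)" "riemann_fan Ul gs Ur"
    using par(1) unfolding interaction_def par(2)[symmetric] by blast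
  have sub: "set fs \<subseteq> fronts D" using fs(1) parents_end by blast
  have wv: "vel M (fst (lst f)) (snd (lst f)) = vel M (fst (rst f)) (snd (rst f))"
      "speed f = vel M (fst (lst f)) (snd (lst f))"
    if "f \<in> set fs" "fam f = W_family" for f
    using w_front[of f] that sub by (auto simp: w_wave_def)
  have "\<exists>f\<in>set fs. fam f = Rho_family"
  proof (rule ccontr)
    assume "\<not> ?thesis"
    then have W: "\<forall>f\<in>set fs. fam f = W_family" using family.exhaust by metis
    have "\<forall>f\<in>set fs. speed f = vel M (fst Ul) (snd Ul)"
      using chain_invariant(2)[OF fs(2), of "\<lambda>U. vel M (fst U) (snd U)"] wv W by simp
    with fs(4) show False by force
  qed
  then obtain as p bs where split: "fs = as @ p # bs" "fam p = Rho_family"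
      "\<forall>f\<in>set bs. fam f \<noteq> Rho_family"
    by (rule split_list_last_propE)
  have W: "fam f = W_family" if "f \<in> set bs" for f
    using split(3) that family.exhaust by metis
  have "chain (rst p) bs Ur" using fs(2) split(1) by (auto simp: chain_append)
  then have "vel M (fst Ur) (snd Ur) = vel M (fst (rst p)) (snd (rst p))"
    using chain_invariant(1)[of "rst p" bs Ur "\<lambda>U. vel M (fst U) (snd U)"] wv W split(1) by simp
  moreover have "vel M (fst (rst h)) (snd (rst h)) \<le> vel M (fst Ur) (snd Ur)"
    by (rule fan_right_velocity[OF gs(2)]) (use gs(1) par(3) h(2) in \<open>auto simp: starting_at_def\<close>)
  moreover have pp: "p \<in> parents D h" using fs(1) split(1) by auto
  moreover have "speed p < speed g" if g: "g \<in> parents D h" "fam g = Rho_family" "g \<noteq> p" for g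
  proof -
    have "g \<in> set as" using g fs(1) split by auto
    then have "speed p \<le> speed g" using fs(3) split(1) by (auto simp: sorted_wrt_append)
    moreover have "speed p \<noteq> speed g"
    proof
      assume eq: "speed p = speed g"
      note pe = parents_end[OF pp] and ge = parents_end[OF g(1)]
      note times = front_times[of p] front_times[of g]
      \<comment> \<open>Two \<open>\<rho>\<close>-fronts with equal speeds that end at one point coincide already at the time \<open>m\<close>,
        inside both lifetimes.\<close>
      define m where "m = (max (t_start p) (t_start g) + t_start h) / 2"
      have m: "t_start p < m" "t_start g < m" "m < t_end p" "m < t_end g"
        using pe ge times by (auto simp: m_def max_def)
      have "pos p m = pos g m" using pe ge eq by (simp add: pos_from_end)
      with rho_fronts_disjoint[of p m g] pe ge m split(2) g show False by auto
    qed
    ultimately show ?thesis by simp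
  qed
  ultimately show ?thesis using that[of p] split(2) by simp
qed

text \<open>A front leaving \<open>J\<close> witnesses that the emitted density \<open>r'\<close> differs from the trace \<open>r\<close>. The Riemann
  solver then takes \<open>r'\<close> from the congested side, either directly or because it
  exceeds the other density of some \<open>r \<le> \<sigma>\<close>. In a fan of rarefactions all right densities are at least \<open>r'\<close>.\<close>

lemma emitted_right_density:
  assumes h: "h \<in> fronts D" "x_start h = junction D"
  shows "sigma M (snd (rst h)) \<le> fst (rst h)"
proof -
  have hs: "h \<in> starting_at D (junction D) (t_start h)"
    using h by (simp add: starting_at_def)
  have "emission M D (t_start h)"
    using front_times[OF h(1)] by (intro emission_at) auto
  then obtain r r' w gs where gs: "set gs = starting_at D (junction D) (t_start h)"
      "riemann_fan (r, w) gs (r', w)" "\<forall>g\<in>set gs. fam g = Rho_family"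
      "r' \<in> emitted_densities M r w"
    unfolding emission_def by (elim exE conjE) (rule that)
  have sub: "set gs \<subseteq> fronts D" using gs(1) by (auto simp: starting_at_def)
  obtain rs Um where rs: "chain (r, w) rs Um" "{g \<in> set gs. fam g = Rho_family} = set rs"
      "length rs \<le> 1 \<or> (\<forall>g\<in>set rs. rarefaction g)"
      "(\<forall>g\<in>set gs. fam g = Rho_family) \<longrightarrow> Um = (r', w)"
    by (rule riemann_fan_rho_part[OF gs(2) sub])
  have Um: "Um = (r', w)" using rs(4) gs(3) by blast
  have hr: "h \<in> set rs" using hs gs rs(2) by auto
  have subr: "set rs \<subseteq> fronts D" using sub rs(2) by auto
  obtain g rs' where rs': "rs = g # rs'" using hr by (cases rs) auto
  have g: "lst g = (r, w)" "g \<in> fronts D" "fam g = Rho_family"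
    using rs(1,2) rs' subr by auto
  then have w: "w \<in> {w_lo M..w_hi M}" and r: "r \<in> {0..rho_max M w}"
    using front_states[of g] by (auto simp: states_def)
  have "r' \<noteq> r \<and> snd (rst h) = w \<and> r' \<le> fst (rst h)"
  proof (cases "length rs \<le> 1")
    case True
    then have "rs = [g]" "g = h" using rs' hr by auto
    then show ?thesis
      using rs(1) Um rho_front[OF g(2,3)] by (auto simp: rho_wave_def)
  next
    case False
    then have all: "\<forall>g\<in>set rs. rarefaction g" using rs by simp
    from rho_fan_decreasing[OF subr all rs(1)] hr Um
    have 1: "snd (rst h) = w" "r' \<le> fst (rst h)" by auto
    have "r' \<le> fst (rst g)" "fst (rst g) < r"
      using rho_fan_decreasing[OF subr all rs(1)] Um rs' g(1) all
      by (auto simp: rarefaction_def)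
    then show ?thesis using 1 by simp
  qed
  moreover have "sigma M w \<le> r'" if "r' \<noteq> r"
  proof (cases "r \<le> sigma M w")
    case True
    then have "other_density M r w < r'"
      using gs(4) that by (auto simp: emitted_densities_def)
    moreover have "sigma M w \<le> other_density M r w"
      using other_density_left[OF model w, of r] other_density_sigma[OF model w] True r
      by (cases "r = sigma M w") auto
    ultimately show ?thesis by simp
  next
    case False
    then show ?thesis using gs(4) by (auto simp: emitted_densities_def)
  qed
  ultimately show ?thesis by auto
qed

section \<open>Tracing a returning wave back to the junction\<close>

text \<open>The trapping argument. The front \<open>g\<close> runs back along a branch known to come from \<open>J\<close> at \<open>t_o\<close>, and
  \<open>p\<close> along the path of rightmost parents; the invariant says that \<open>p\<close> is \<open>g\<close> or lies to the right of \<open>g\<close>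
  at some time of their common lifetime. Whichever of the two fronts starts later is replaced by a
  parent, both if they start together. The path of \<open>p\<close> can neither leave through the left end nor begin with the initial datum,
  since it lies to the right of \<open>g\<close>, which persists back to \<open>t_o\<close>; when it
  reaches \<open>J\<close>, this happens at \<open>t_o\<close> by the maximality of \<open>t_o\<close>.\<close>

lemma rightmost_branch_reaches_junction:
  assumes S: "S \<in> fronts D" "fam S = Rho_family"
    and latest: "\<forall>f\<in>wave_branch D S. x_start f = junction D \<longrightarrow> t_start f \<le> t_o"
    and "p \<in> wave_branch D S" "g \<in> wave_branch D S"
    and "\<exists>g0\<in>wave_branch D g. x_start g0 = junction D \<and> t_start g0 = t_o"
    and "p = g \<or> (\<exists>s. t_start p < s \<and> s \<le> t_end p \<and> t_start g < s \<and> s \<le> t_end g \<and>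
      pos g s < pos p s)"
  shows "\<exists>f\<in>wave_branch D S. x_start f = junction D \<and> t_start f = t_o \<and>
    vel M (fst (rst p)) (snd (rst p)) \<le> vel M (fst (rst f)) (snd (rst f))"
  using assms(4-)
proof (induction "rank D p + rank D g" arbitrary: p g rule: less_induct)
  case less
  have pf: "p \<in> fronts D" "fam p = Rho_family" and gf: "g \<in> fronts D" "fam g = Rho_family"
    using wave_tree_fronts[OF wave_branch_subset_tree] wave_branch_fam less.prems S by auto
  obtain g0 where g0: "g0 \<in> wave_branch D g" "x_start g0 = junction D" "t_start g0 = t_o"
    using less.prems by blast
  have g_late: "t_o \<le> t_start g" using wave_branch_earlier[OF g0(1)] g0 by simp
  have back_g: "\<exists>g'. g' \<in> parents D g \<and> fam g' = Rho_family \<and> g0 \<in> wave_branch D g'"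
    if "x_start g \<noteq> junction D"
    using wave_branch_first_step[OF g0(1)] g0 that gf by auto
  have branch_step: "k \<in> wave_branch D S" if "h \<in> wave_branch D S" "k \<in> parents D h" "fam k = Rho_family" for h k
    using wave_branch.parent[OF that(1,2)] that(3) S by simp
  consider (later) "t_start g < t_start p" | (earlier) "t_start p < t_start g"
    | (same) "t_start p = t_start g" by linarith
  then show ?case
  proof cases
    case later
    then obtain s where s: "t_start p < s" "s \<le> t_end p" "t_start g < s" "s \<le> t_end g"
        "pos g s < pos p s"
      using less.prems(4) by auto
    have lt: "pos g (t_start p) < x_start p"
      using strictly_right_of_start[OF pf gf s, of "t_start p"] later s pos_start[of p] by simp
    \<comment> \<open>As \<open>g\<close> started at \<open>t_o\<close> or later, \<open>p\<close> starts after \<open>t_o\<close>; the branch of \<open>S\<close> contains no such emission.\<close>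
    have "x_start p \<noteq> junction D"
      using latest less.prems(1) g_late later by auto
    moreover have "interior_pt D (pos g (t_start p))"
      using front_interior[OF gf(1)] later s by auto
    ultimately have int: "interior_pt D (x_start p)"
      using lt start_le_junction[OF pf(1)]
      by (auto simp: interior_pt_def intro: less_trans)
    have "interaction D (x_start p) (t_start p)"
      by (rule interaction_at[of _ _ p])
        (use int later front_times[OF pf(1)] front_times[OF gf(1)] pf in \<open>auto simp: starting_at_def\<close>)
    then obtain k where "k \<in> parents D p"
      using int unfolding interaction_def parents_def by auto
    then obtain p' where p': "p' \<in> parents D p" "fam p' = Rho_family"
        "vel M (fst (rst p)) (snd (rst p)) \<le> vel M (fst (rst p')) (snd (rst p'))"
      using rightmost_rho_parent[OF pf] by metis
    note e = parents_end[OF p'(1)]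
    have "pos p' (t_start p) = x_start p" using e pos_end[of p'] by simp
    then have "\<exists>s. t_start p' < s \<and> s \<le> t_end p' \<and> t_start g < s \<and> s \<le> t_end g \<and> pos g s < pos p' s"
      using e lt later s front_times[of p'] by (intro exI[of _ "t_start p"]) auto
    moreover have "rank D p' + rank D g < rank D p + rank D g"
      using rank_parent[OF p'(1)] by simp
    ultimately have "\<exists>f\<in>wave_branch D S. x_start f = junction D \<and> t_start f = t_o \<and>
        vel M (fst (rst p')) (snd (rst p')) \<le> vel M (fst (rst f)) (snd (rst f))"
      using less.hyps[of p' g] branch_step[OF less.prems(1) p'(1,2)] less.prems(2,3) by blast
    then show ?thesis using p'(3) by force
  next
    case earlier
    then obtain s where s: "t_start p < s" "s \<le> t_end p" "t_start g < s" "s \<le> t_end g"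
        "pos g s < pos p s"
      using less.prems(4) by auto
    have lt: "x_start g < pos p (t_start g)"
      using strictly_right_of_start[OF pf gf s, of "t_start g"] earlier s pos_start[of g] by simp
    moreover have "pos p (t_start g) < junction D"
      using front_interior[OF pf(1), of "t_start g"] earlier s by (auto simp: interior_pt_def)
    ultimately obtain g' where g': "g' \<in> parents D g" "fam g' = Rho_family" "g0 \<in> wave_branch D g'"
      using back_g by force
    note e = parents_end[OF g'(1)]
    have "pos g' (t_start g) = x_start g" using e pos_end[of g'] by simp
    then have "\<exists>s. t_start p < s \<and> s \<le> t_end p \<and> t_start g' < s \<and> s \<le> t_end g' \<and> pos g' s < pos p s"
      using e lt earlier s front_times[of g'] by (intro exI[of _ "t_start g"]) auto
    moreover have "rank D p + rank D g' < rank D p + rank D g"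
      using rank_parent[OF g'(1)] by simp
    ultimately show ?thesis
      using less.hyps[of p g'] branch_step[OF less.prems(2) g'(1,2)] less.prems(1) g'(3) g0 by blast
  next
    case same
    have le: "x_start g \<le> x_start p"
    proof (cases "p = g")
      case False
      then obtain s where s: "t_start p < s" "s \<le> t_end p" "t_start g < s" "s \<le> t_end g"
          "pos g s < pos p s"
        using less.prems(4) by auto
      show ?thesis
        using stays_right[OF pf gf s, of "t_start p"] same s pos_start[of g] pos_start[of p] by simp
    qed simp
    show ?thesis
    proof (cases "x_start p = junction D")
      case True
      then have "t_start p = t_o" using latest less.prems(1) g_late same by force
      then show ?thesis using True less.prems(1) by blast
    next
      case False
      then have lt: "x_start p < junction D" using start_le_junction[OF pf(1)] by simp
      then obtain g' where g': "g' \<in> parents D g" "fam g' = Rho_family" "g0 \<in> wave_branch D g'"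
        using back_g le by force
      note eg = parents_end[OF g'(1)]
      have int: "interior_pt D (x_start p)"
        using parents_interior[OF g'(1)] le lt
        by (auto simp: interior_pt_def intro: less_le_trans)
      have "interaction D (x_start p) (t_start p)"
        by (rule interaction_at[of _ _ p])
          (use int same eg front_times[OF pf(1)] front_times[of g'] pf in \<open>auto simp: starting_at_def\<close>)
      then obtain k where "k \<in> parents D p"
        using int unfolding interaction_def parents_def by auto
      then obtain p' where p': "p' \<in> parents D p" "fam p' = Rho_family"
          "vel M (fst (rst p)) (snd (rst p)) \<le> vel M (fst (rst p')) (snd (rst p'))"
          "\<And>h. h \<in> parents D p \<Longrightarrow> fam h = Rho_family \<Longrightarrow> h \<noteq> p' \<Longrightarrow> speed p' < speed h"
        using rightmost_rho_parent[OF pf] by metis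
      note ep = parents_end[OF p'(1)]
      note times = front_times[of p'] front_times[of g']
      have "p' = g' \<or> (\<exists>s. t_start p' < s \<and> s \<le> t_end p' \<and> t_start g' < s \<and> s \<le> t_end g' \<and>
          pos g' s < pos p' s)"
      proof (cases "x_start g = x_start p")
        case True
        then have par: "g' \<in> parents D p"
          using g'(1) same int by (simp add: parents_def)
        \<comment> \<open>Both fronts start at the same point, so \<open>g'\<close> is among the parents of \<open>p\<close>. If it is not the rightmost one,
          then it is faster, hence further left at the time \<open>m\<close> shortly before the interaction.\<close>
        show ?thesis
        proof (cases "g' = p'")
          case False
          then have sp: "speed p' < speed g'" using p'(4) par g'(2) by blast
          define m where "m = (max (t_start p') (t_start g') + t_start p) / 2"
          have m: "t_start p' < m" "t_start g' < m" "m < t_start p"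
            using ep eg same times by (auto simp: m_def max_def)
          have "speed p' * (t_start p - m) < speed g' * (t_start p - m)"
            using sp m by (intro mult_strict_right_mono) auto
          then have "pos g' m < pos p' m"
            using ep eg same True by (simp add: pos_from_end)
          then show ?thesis using m ep eg same by (intro disjI2 exI[of _ m]) auto
        qed simp
      next
        case False
        then have "pos g' (t_start p) < pos p' (t_start p)"
          using ep eg le same pos_end[of g'] pos_end[of p'] by simp
        then show ?thesis
          using ep eg same times by (intro disjI2 exI[of _ "t_start p"]) auto
      qed
      moreover have "rank D p' + rank D g' < rank D p + rank D g"
        using rank_parent[OF p'(1)] rank_parent[OF g'(1)] by simp
      ultimately have "\<exists>f\<in>wave_branch D S. x_start f = junction D \<and> t_start f = t_o \<and>
          vel M (fst (rst p')) (snd (rst p')) \<le> vel M (fst (rst f)) (snd (rst f))"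
        using less.hyps[of p' g'] branch_step[OF less.prems(1) p'(1,2)]
          branch_step[OF less.prems(2) g'(1,2)] g'(3) g0 by blast
      then show ?thesis using p'(3) by force
    qed
  qed
qed

lemma returning_rarefaction_origin:
  assumes S: "returning_wave D S t_o t_a" "rarefaction S"
  obtains f where "f \<in> wave_branch D S" "x_start f = junction D" "t_start f = t_o"
    "delta_minus M S < C_star M * \<bar>snd (lst S) - snd (lst f)\<bar>"
proof -
  have Sf: "S \<in> fronts D" "fam S = Rho_family"
    using S by (auto simp: returning_wave_def rarefaction_def)
  obtain f where f: "f \<in> wave_branch D S" "x_start f = junction D" "t_start f = t_o"
    "vel M (fst (rst S)) (snd (rst S)) \<le> vel M (fst (rst f)) (snd (rst f))"
    using rightmost_branch_reaches_junction[OF Sf, of t_o S S] S(1) wave_branch.self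
    unfolding returning_wave_def by blast
  have ff: "f \<in> fronts D" "fam f = Rho_family"
    using wave_tree_fronts[OF wave_branch_subset_tree[OF f(1)] Sf(1)] wave_branch_fam[OF f(1)] Sf
    by auto
  have w: "snd (lst f) = snd (rst f)" "snd (lst S) = snd (rst S)"
    using rho_front[OF ff] rho_front[OF Sf] by (auto simp: rho_wave_def)
  have sig: "sigma M (snd (lst f)) \<le> fst (rst f)"
    using emitted_right_density[OF ff(1) f(2)] w by simp
  have "flux M (fst (lst S)) (snd (lst S)) - flux M (fst (rst S)) (snd (lst S))
      < C_star M * \<bar>snd (lst S) - snd (lst f)\<bar>"
  proof (rule rarefaction_flux_drop[OF model])
    show "(fst (rst f), snd (lst f)) \<in> states M"
      using front_states[OF ff(1)] w(1) by simp
    show "(fst (lst S), snd (lst S)) \<in> states M"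
      using front_states[OF Sf(1)] by simp
    show "(fst (rst S), snd (lst S)) \<in> states M"
      using front_states[OF Sf(1)] w(2) by simp
  qed (use sig S(2) f(4) w in \<open>auto simp: rarefaction_def\<close>)
  then have "delta_minus M S < C_star M * \<bar>snd (lst S) - snd (lst f)\<bar>"
    using w by (simp add: delta_minus_def delta_plus_def state_flux_def)
  with that f show ?thesis by blast
qed

section \<open>Trees without contact discontinuities, and levels\<close>

text \<open>At an interaction of \<open>\<rho>\<close>-waves the value of \<open>w\<close> is that of the left end of the interaction, for
  the incoming fronts and for the outgoing \<open>\<rho>\<close>-fronts.\<close>

lemma rho_tree_constant_w:
  assumes "g \<in> wave_tree D S" "S \<in> fronts D" "\<forall>f\<in>wave_tree D S. fam f = Rho_family"
  shows "snd (lst g) = snd (lst S)"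
  using assms(1)
proof (induction rule: wave_tree.induct)
  case (parent h g)
  have h: "h \<in> fronts D" "fam h = Rho_family"
    using wave_tree_fronts parent.hyps(1) assms by auto
  note par = parents_interaction[OF h(1) parent.hyps(2)]
  obtain Ul Ur fs gs where fs: "set fs = parents D h" "chain Ul fs Ur"
    and gs: "set gs = starting_at D (x_start h) (t_start h)" "riemann_fan Ul gs Ur"
    using par(1) unfolding interaction_def par(2)[symmetric] by blast
  have rho_const: "snd (lst f) = snd (rst f)" if "f \<in> fronts D" "fam f = Rho_family" for f
    using rho_front[OF that] by (simp add: rho_wave_def)
  have "fam f = Rho_family" if "f \<in> set fs" for f
    using that fs(1) assms(3) wave_tree.parent[OF parent.hyps(1)] by blast
  then have "\<forall>f\<in>set fs. snd (lst f) = snd (rst f)"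
    using rho_const fs(1) parents_end by blast
  from chain_invariant(2)[OF fs(2) this] have 1: "snd (lst g) = snd Ul"
    using fs(1) parent.hyps(2) by blast
  have sub: "set gs \<subseteq> fronts D" using gs(1) by (auto simp: starting_at_def)
  obtain rs Um where rs: "chain Ul rs Um" "{g \<in> set gs. fam g = Rho_family} = set rs"
    by (rule riemann_fan_rho_part[OF gs(2) sub])
  have "\<forall>f\<in>set rs. snd (lst f) = snd (rst f)" using rho_const sub rs(2) by blast
  from chain_invariant(2)[OF rs(1) this] have "snd (lst h) = snd Ul"
    using rs(2) gs(1) par(3) h(2) by blast
  with 1 parent.IH show ?case by simp
qed simp

lemma has_level_bounds:
  assumes "has_level D S t_o f k" "S \<in> fronts D"
  shows "1 \<le> k \<and> k \<le> Suc (rank D f)"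
  using assms
proof (induction rule: has_level.induct)
  case (meets_w f g h k)
  then show ?case using rank_parent[OF meets_w.hyps(3)] by auto
next
  case (meets_rho f g k)
  then show ?case using rank_parent[OF meets_rho.hyps(3)] by auto
qed simp

lemma finite_levels:
  assumes "S \<in> fronts D"
  shows "finite {k. \<exists>f. has_level D S t_o f k}"
proof (rule finite_subset)
  show "{k. \<exists>f. has_level D S t_o f k} \<subseteq> {..Suc (card (fronts D))}"
  proof
    fix k assume "k \<in> {k. \<exists>f. has_level D S t_o f k}"
    then obtain f where "has_level D S t_o f k" by blast
    then have "k \<le> Suc (rank D f)" using has_level_bounds assms by blast
    moreover have "rank D f \<le> card (fronts D)"
      unfolding rank_def by (rule card_mono) (use finite_fronts in auto)
    ultimately show "k \<in> {..Suc (card (fronts D))}" by simp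
  qed
qed simp

text \<open>Only the first rule for levels applies to a front that starts at \<open>t_o\<close>.\<close>

lemma level_original:
  assumes "f \<in> wave_tree D S" "t_start f = t_o" "S \<in> fronts D"
  shows "level D S t_o f = 1"
proof -
  have "t_o < t_end f" using front_times[of f] wave_tree_fronts assms by auto
  then have "{k. has_level D S t_o f k} = {1}"
    using assms by (auto elim: has_level.cases intro: has_level.original[unfolded One_nat_def])
  then show ?thesis by (simp add: level_def)
qed

text \<open>A \<open>\<rho>\<close>-parent with a level gives its child a level, whether or not a contact discontinuity takes part in the
  interaction. So \<open>S\<close> has some level and \<open>level\<close> is a maximum over a nonempty set.\<close>

lemma level_transfer:
  assumes "g \<in> wave_branch D S" "fam S = Rho_family" "t_o \<le> t_start g" "has_level D S t_o g k"
  shows "\<exists>k. has_level D S t_o S k"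
  using assms
proof (induction arbitrary: k rule: wave_branch.induct)
  case (parent h g)
  have g: "fam g = Rho_family" using parent by simp
  have late: "t_o < t_start h"
    using parents_end[OF parent.hyps(2)] front_times[of g] parent.prems by auto
  have tree: "h \<in> wave_tree D S" using wave_branch_subset_tree parent.hyps(1) by blast
  have "\<exists>k'. has_level D S t_o h k'"
  proof (cases "\<forall>f\<in>parents D h. fam f = Rho_family")
    case True
    then show ?thesis using has_level.meets_rho[OF tree late parent.hyps(2) g] parent.prems by blast
  next
    case False
    then obtain f where "f \<in> parents D h" "fam f = W_family" using family.exhaust by metis
    then show ?thesis
      using has_level.meets_w[OF tree late parent.hyps(2) g] parent.prems by blast
  qed
  then show ?case using parent.IH parent.prems late by auto
qed auto

lemma level_returning:
  assumes S: "S \<in> fronts D" "fam S = Rho_family"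
    and f: "f \<in> wave_branch D S" "t_start f = t_o"
  shows "1 \<le> level D S t_o S" "level D S t_o S \<le> returning_order D S t_o"
proof -
  have ft: "f \<in> wave_tree D S" by (rule wave_branch_subset_tree[OF f(1)])
  then have "t_o < t_end f" using front_times[of f] wave_tree_fronts S f by auto
  then have "has_level D S t_o f 1" using ft f by (intro has_level.original) auto
  then have ne: "{k. has_level D S t_o S k} \<noteq> {}"
    using level_transfer[OF f(1) S(2)] f(2) by auto
  have sub: "{k. has_level D S t_o S k} \<subseteq> {k. \<exists>f. has_level D S t_o f k}" by auto
  note fin = finite_levels[OF S(1), of t_o]
  have "level D S t_o S \<in> {k. has_level D S t_o S k}"
    unfolding level_def by (rule Max_in[OF finite_subset[OF sub fin] ne])
  then show "1 \<le> level D S t_o S" using has_level_bounds S by auto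
  show "level D S t_o S \<le> returning_order D S t_o"
    unfolding level_def returning_order_def by (rule Max_mono[OF sub ne fin])
qed

end

lemma TV_tree_upper:
  assumes "1 \<le> k" "k \<le> K"
  shows "\<bar>wk k - wk 1\<bar> \<le> TV_tree wk K"
proof -
  have "\<bar>wk k - wk 1\<bar> \<le> TV_tree wk k"
    using assms(1)
  proof (induction k rule: dec_induct)
    case (step k)
    have "TV_tree wk (Suc k) = TV_tree wk k + \<bar>wk (Suc k) - wk k\<bar>"
      using step by (simp add: TV_tree_def)
    with step show ?case by linarith
  qed (simp add: TV_tree_def)
  also have "\<dots> \<le> TV_tree wk K"
    unfolding TV_tree_def by (rule sum_mono2) (use assms in auto)
  finally show ?thesis .
qed

section \<open>Flux variation of a returning wave\<close>

theorem proposition5p12: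
  fixes M :: model and n i :: nat and D :: "nat \<Rightarrow> road" and S :: front and t_o t_a :: real
  assumes "traffic_model M"
    and "\<forall>j\<in>{1..n}. incoming_wft M (D j)"
    and "i \<in> {1..n}"
    and "returning_wave (D i) S t_o t_a"
  shows
    "(shock S \<or>
      (rarefaction S \<and>
        other_density M (fst (lst S)) (snd (lst S)) < fst (rst S) \<and>
        fst (rst S) < sigma M (snd (rst S)) \<and>
        sigma M (snd (lst S)) < fst (lst S)) \<or>
      (\<forall>f\<in>wave_tree (D i) S. fam f = Rho_family)
      \<longrightarrow> delta_minus M S < 0)
    \<and>
    (\<forall>L R.
      rarefaction S \<and>
      fst (rst S) < other_density M (fst (lst S)) (snd (lst S)) \<and>
      other_density M (fst (lst S)) (snd (lst S)) < sigma M (snd (lst S)) \<and>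
      sigma M (snd (lst S)) < fst (lst S) \<and>
      parents (D i) S = {L, R} \<and>
      fam L = W_family \<and> lst L = lst S \<and>
      fam R = Rho_family \<and> lst R = rst L \<and>
      x_start R = junction (D i) \<and> t_start R = t_o
      \<longrightarrow> 0 < delta_minus M S \<and>
          delta_minus M S < C_star M * \<bar>snd (rst L) - snd (lst L)\<bar>)
    \<and>
    (\<forall>K wk.
      rarefaction S \<and> 0 < delta_minus M S \<and>
      returning_order (D i) S t_o = K \<and> level_values (D i) S t_o wk
      \<longrightarrow> delta_minus M S \<le> C_star M * TV_tree wk K
            + (\<Sum>f\<in>original_rho_waves (D i) S t_o. max 0 (delta_minus M f)))"
proof -
  note model = assms(1)
  have road: "incoming_wft M (D i)" using assms(2,3) by blast
  note ret = assms(4)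
  have S: "S \<in> fronts (D i)" "x_end S = junction (D i)"
    using ret by (auto simp: returning_wave_def)
  have speed: "0 < speed S" by (rule reaching_junction_speed_pos[OF model road S])
  have w: "snd (lst S) = snd (rst S)" if "fam S = Rho_family"
    using rho_front[OF model road S(1) that] by (simp add: rho_wave_def)
  have range: "snd (lst S) \<in> {w_lo M..w_hi M}" "0 \<le> fst (lst S)"
      "fst (lst S) \<le> rho_max M (snd (lst S))" "0 \<le> fst (rst S)"
    using front_states[OF model road S(1)] by (auto simp: states_def)
  have dm: "delta_minus M S = flux M (fst (lst S)) (snd (lst S)) - flux M (fst (rst S)) (snd (rst S))"
    by (simp add: delta_minus_def delta_plus_def state_flux_def)
  have shock_case: "delta_minus M S < 0" if "shock S"
  proof -
    have "fam S = Rho_family" "fst (lst S) < fst (rst S)" using that by (auto simp: shock_def)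
    moreover from this have "speed S = delta_plus M S / (fst (rst S) - fst (lst S))"
      using rho_front[OF model road S(1)] that by (auto simp: rho_wave_def)
    ultimately have "0 < delta_plus M S" using speed by (simp add: zero_less_divide_iff)
    then show ?thesis by (simp add: delta_minus_def)
  qed
  have 1: "delta_minus M S < 0" if "shock S \<or>
      (rarefaction S \<and>
        other_density M (fst (lst S)) (snd (lst S)) < fst (rst S) \<and>
        fst (rst S) < sigma M (snd (rst S)) \<and>
        sigma M (snd (lst S)) < fst (lst S)) \<or>
      (\<forall>f\<in>wave_tree (D i) S. fam f = Rho_family)"
    using that
  proof (elim disjE conjE)
    assume r: "rarefaction S" and o: "other_density M (fst (lst S)) (snd (lst S)) < fst (rst S)"
      "fst (rst S) < sigma M (snd (rst S))" "sigma M (snd (lst S)) < fst (lst S)"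
    have ws: "snd (lst S) = snd (rst S)" using w r by (simp add: rarefaction_def)
    note od = other_density_right[OF model range(1) o(3) range(3)]
    have "flux M (fst (lst S)) (snd (lst S)) < flux M (fst (rst S)) (snd (lst S))"
      using flux_increasing[OF model range(1) od(1) o(1)] o(2) od(2) ws by simp
    then show ?thesis using dm ws by simp
  next
    assume all: "\<forall>f\<in>wave_tree (D i) S. fam f = Rho_family"
    then have fam: "fam S = Rho_family" using wave_tree.self by blast
    show ?thesis
    proof (cases "shock S")
      case False
      then have "rarefaction S"
        using fam rho_front[OF model road S(1) fam]
        by (auto simp: shock_def rarefaction_def rho_wave_def)
      then obtain f where f: "f \<in> wave_branch (D i) S"
          "delta_minus M S < C_star M * \<bar>snd (lst S) - snd (lst f)\<bar>"
        using returning_rarefaction_origin[OF model road ret] by metis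
      have "snd (lst f) = snd (lst S)"
        using rho_tree_constant_w[OF model road wave_branch_subset_tree[OF f(1)] S(1) all] .
      with f(2) show ?thesis by simp
    qed (rule shock_case)
  qed (rule shock_case)
  have 2: "0 < delta_minus M S \<and> delta_minus M S < C_star M * \<bar>snd (rst L) - snd (lst L)\<bar>"
    if r: "rarefaction S"
      and o: "fst (rst S) < other_density M (fst (lst S)) (snd (lst S))"
        "other_density M (fst (lst S)) (snd (lst S)) < sigma M (snd (lst S))"
        "sigma M (snd (lst S)) < fst (lst S)"
      and par: "parents (D i) S = {L, R}"
      and L: "fam L = W_family" "lst L = lst S"
      and R: "lst R = rst L" "x_start R = junction (D i)"
    for L R
  proof
    have ws: "snd (lst S) = snd (rst S)" using w r by (simp add: rarefaction_def)
    note od = other_density_right[OF model range(1) o(3) range(3)]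
    have "flux M (fst (rst S)) (snd (lst S)) < flux M (fst (lst S)) (snd (lst S))"
      using flux_increasing[OF model range(1,4) o(1)] o(2) od(2) by simp
    then show "0 < delta_minus M S" using dm ws by simp
    obtain f where f: "f \<in> wave_branch (D i) S" "x_start f = junction (D i)"
        "delta_minus M S < C_star M * \<bar>snd (lst S) - snd (lst f)\<bar>"
      using returning_rarefaction_origin[OF model road ret r] by metis
    \<comment> \<open>The branch contains no front of the second family, so it can only step back to \<open>R\<close>, where it stops
      at the junction.\<close>
    have "interior_pt (D i) (x_start S)" using parents_interior[of L "D i" S] par by simp
    then have "f \<noteq> S" using f(2) by (auto simp: interior_pt_def)
    then obtain h where h: "h \<in> {L, R}" "fam h = fam S" "f \<in> wave_branch (D i) h"
      using wave_branch_first_step[OF f(1)] par by auto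
    then have "h = R" using L r by (auto simp: rarefaction_def)
    moreover have "parents (D i) R = {}"
      using R(2) by (simp add: parents_def interior_pt_def)
    ultimately have "f = R" using wave_branch_first_step[OF h(3)] by auto
    with f(3) L R show "delta_minus M S < C_star M * \<bar>snd (rst L) - snd (lst L)\<bar>"
      by (simp add: abs_minus_commute)
  qed
  have 3: "delta_minus M S \<le> C_star M * TV_tree wk (returning_order (D i) S t_o)
      + (\<Sum>f\<in>original_rho_waves (D i) S t_o. max 0 (delta_minus M f))"
    if r: "rarefaction S" "0 < delta_minus M S" and lev: "level_values (D i) S t_o wk" for wk
  proof -
    have fam: "fam S = Rho_family" using r by (simp add: rarefaction_def)
    obtain f where f: "f \<in> wave_branch (D i) S" "x_start f = junction (D i)" "t_start f = t_o"
        "delta_minus M S < C_star M * \<bar>snd (lst S) - snd (lst f)\<bar>"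
      using returning_rarefaction_origin[OF model road ret r(1)] by metis
    have "snd (lst f) = wk 1"
      using lev f wave_branch.self level_original[OF model road wave_branch_subset_tree[OF f(1)] f(3) S(1)]
      unfolding level_values_def by metis
    moreover have "snd (lst S) = wk (level (D i) S t_o S)"
      using lev f wave_branch.self unfolding level_values_def by metis
    moreover have "\<bar>wk (level (D i) S t_o S) - wk 1\<bar> \<le> TV_tree wk (returning_order (D i) S t_o)"
      using level_returning[OF model road S(1) fam f(1,3)] by (rule TV_tree_upper)
    \<comment> \<open>A negative constant would contradict the strict bound for the positive variation.\<close>
    moreover have "0 \<le> C_star M"
    proof (rule ccontr)
      assume "\<not> ?thesis"
      then have "C_star M * \<bar>snd (lst S) - snd (lst f)\<bar> \<le> 0" by (simp add: mult_nonpos_nonneg)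
      with f(4) r(2) show False by simp
    qed
    ultimately have "C_star M * \<bar>snd (lst S) - snd (lst f)\<bar>
        \<le> C_star M * TV_tree wk (returning_order (D i) S t_o)"
      by (simp add: mult_left_mono)
    moreover have "0 \<le> (\<Sum>f\<in>original_rho_waves (D i) S t_o. max 0 (delta_minus M f))"
      by (rule sum_nonneg) simp
    ultimately show ?thesis using f(4) by linarith
  qed
  show ?thesis
    using 1 2 3 by blast
qed

end
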